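(* Let $n\ge 1$ and let $\lambda/\mu$ be a skew shape with $\gcd(|\lambda/\mu|,n)=1$. Then the triple $$\bigl(\mathrm{SSYT}(\lambda/\mu,n),\ \langle c_n\rangle,\ \mathrm{s}_{\lambda/\mu}(1,q,\dots,q^{n-1})\bigr)$$ exhibits the cyclic sieving phenomenon. Moreover, if $\mu=\emptyset$, then $$\bigl(\mathrm{SSYT}(\lambda,n),\ \langle c_n\rangle,\ q^{-n(\lambda)}\,\mathrm{s}_{\lambda}(1,q,\dots,q^{n-1})\bigr)$$ also exhibits the cyclic sieving phenomenon.
   Context: Cyclic sieving: given a finite set $X$, a cyclic group $C$ of order $n$ acting on $X$, and a polynomial $f(q)$, the triple $(X,C,f(q))$ exhibits the cyclic sieving phenomenon if for all $k\in\mathbb{Z}$, $|\{x\in X: g^k\cdot x=x\}|=f(\xi^k)$, where $g$ is a generator of $C$ and $\xi$ is a primitive $n$th root of unity. For a skew shape $\lambda/\mu$, $|\lambda/\mu|=|\lambda|-|\mu|$ is its number of boxes. $\mathrm{SSYT}(\lambda/\mu,n)$ is the set of semistandard Young tableaux of shape $\lambda/\mu$ (English notation, rows weakly increasing, columns strictly increasing) with entries in $\{1,\dots,n\}$; for $\mu=\emptyset$ it is written $\mathrm{SSYT}(\lambda,n)$. $w_i(T)$ is the number of entries of $T$ equal to $i$. The skew Schur polynomial is $\mathrm{s}_{\lambda/\mu}(x_1,\dots,x_n)=\sum_{T\in\mathrm{SSYT}(\lambda/\mu,n)}x_1^{w_1(T)}\cdots x_n^{w_n(T)}$, and $\mathrm{s}_\lambda=\mathrm{s}_{\lambda/\emptyset}$.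 For a partition $\lambda$, $n(\lambda)=\sum_j (j-1)\lambda_j$ (not to be confused with the integer $n$). For $1\le i\le n-1$ the crystal reflection operator $\tilde s_i$ acts on $T\in\mathrm{SSYT}(\lambda/\mu,n)$ as follows. Read the entries of $T$ row by row, from the bottom row to the top row, each row left to right. Replace each $i+1$ by "(" and each $i$ by ")" and match parentheses in the usual way. The unmatched letters form a subword $i^a(i+1)^b$; change these entries, in their positions, to $i^b(i+1)^a$, leaving all other entries unchanged. The result $\tilde s_i(T)$ is again in $\mathrm{SSYT}(\lambda/\mu,n)$, and $\tilde s_1,\dots,\tilde s_{n-1}$ define an action of the symmetric group $S_n$ on $\mathrm{SSYT}(\lambda/\mu,n)$ with $\tilde s_i$ the action of the simple transposition $(i\ i+1)$. Set $c_n=\tilde s_1\tilde s_2\cdots\tilde s_{n-1}$ (with $\tilde s_1$ applied first), the action of an $n$-cycle; it sends a tableau with $(w_1,\dots,w_n)=(\alpha_1,\dots,\alpha_n)$ to one with $(w_1,\dots,w_n)=(\alpha_2,\dots,\alpha_n,\alpha_1)$. Here $\langle c_n\rangle$ denotes the cyclic subgroup of order $n$ of $S_n$ generated by this $n$-cycle, acting on tableaux in this way. *)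

theory Defs
  imports
    "HOL-Algebra.Sym_Groups"
    "HOL-Algebra.Group_Action"
    "HOL-Algebra.Elementary_Groups"
    "HOL-Computational_Algebra.Polynomial"
    Complex_Main
begin

section \<open>Cyclic sieving\<close>

definition primitive_root_of_unity :: "nat \<Rightarrow> complex \<Rightarrow> bool" where
  "primitive_root_of_unity n \<xi> \<longleftrightarrow> n > 0 \<and> \<xi> ^ n = 1 \<and> (\<forall>m. 0 < m \<and> m < n \<longrightarrow> \<xi> ^ m \<noteq> 1)"

text \<open>
  The condition is imposed for every generator of the group and every primitive root of unity.
  For polynomials with integer coefficients both sides of the equation
  depend only on \<open>gcd k n\<close>, so this agrees with fixing one choice of each.
  Elements of \<open>BijGroup X\<close> are extensional functions on \<open>X\<close>.
\<close>

definition cyclic_sieving ::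
    "'x set \<Rightarrow> ('g, 'm) monoid_scheme \<Rightarrow> ('g \<Rightarrow> 'x \<Rightarrow> 'x) \<Rightarrow> int poly \<Rightarrow> bool" where
  "cyclic_sieving X C act f \<longleftrightarrow>
     finite X \<and> finite (carrier C) \<and> cyclic_group C \<and> group_action C X act \<and>
     (\<forall>g \<in> carrier C. \<forall>\<xi>.
        subgroup_generated C {g} = C \<and> primitive_root_of_unity (card (carrier C)) \<xi> \<longrightarrow>
        (\<forall>k :: int. of_nat (card {x \<in> X. act (g [^]\<^bsub>C\<^esub> k) x = x})
                      = poly (map_poly of_int f) (\<xi> powi k)))"


section \<open>Skew shapes and semistandard tableaux\<close>

text \<open>
  Rows and columns are numbered from 0: the part usually written \<open>\<lambda>\<^sub>j\<close> is \<open>lam (j - 1)\<close>.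
  Entries of tableaux are numbered from 1.
\<close>

definition is_partition :: "(nat \<Rightarrow> nat) \<Rightarrow> bool" where
  "is_partition lam \<longleftrightarrow> antimono lam \<and> finite {i. lam i \<noteq> 0}"

definition empty_partition :: "nat \<Rightarrow> nat" where
  "empty_partition = (\<lambda>_. 0)"

definition partition_size :: "(nat \<Rightarrow> nat) \<Rightarrow> nat" where
  "partition_size lam = (\<Sum>i | lam i \<noteq> 0. lam i)"

definition partition_length :: "(nat \<Rightarrow> nat) \<Rightarrow> nat" where
  "partition_length lam = card {i. lam i \<noteq> 0}"

definition partition_n :: "(nat \<Rightarrow> nat) \<Rightarrow> nat" where
  "partition_n lam = (\<Sum>i | lam i \<noteq> 0. i * lam i)"

definition skew_shape :: "(nat \<Rightarrow> nat) \<Rightarrow> (nat \<Rightarrow> nat) \<Rightarrow> bool" where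
  "skew_shape lam mu \<longleftrightarrow> is_partition lam \<and> is_partition mu \<and> (\<forall>i. mu i \<le> lam i)"

definition skew_size :: "(nat \<Rightarrow> nat) \<Rightarrow> (nat \<Rightarrow> nat) \<Rightarrow> nat" where
  "skew_size lam mu = partition_size lam - partition_size mu"

definition diagram :: "(nat \<Rightarrow> nat) \<Rightarrow> (nat \<Rightarrow> nat) \<Rightarrow> (nat \<times> nat) set" where
  "diagram lam mu = {(i, j). mu i \<le> j \<and> j < lam i}"

definition SSYT :: "(nat \<Rightarrow> nat) \<Rightarrow> (nat \<Rightarrow> nat) \<Rightarrow> nat \<Rightarrow> (nat \<times> nat \<Rightarrow> nat) set" where
  "SSYT lam mu n = {T \<in> diagram lam mu \<rightarrow>\<^sub>E {1..n}.
     (\<forall>i j j'. (i, j) \<in> diagram lam mu \<and> (i, j') \<in> diagram lam mu \<and> j < j'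
         \<longrightarrow> T (i, j) \<le> T (i, j')) \<and>
     (\<forall>i i' j. (i, j) \<in> diagram lam mu \<and> (i', j) \<in> diagram lam mu \<and> i < i'
         \<longrightarrow> T (i, j) < T (i', j))}"

definition weight ::
    "(nat \<Rightarrow> nat) \<Rightarrow> (nat \<Rightarrow> nat) \<Rightarrow> (nat \<times> nat \<Rightarrow> nat) \<Rightarrow> nat \<Rightarrow> nat" where
  "weight lam mu T i = card {b \<in> diagram lam mu. T b = i}"

text \<open>The value of the skew Schur polynomial at the point \<open>(x 1, \<dots>, x n)\<close>.\<close>

definition skew_schur ::
    "(nat \<Rightarrow> nat) \<Rightarrow> (nat \<Rightarrow> nat) \<Rightarrow> nat \<Rightarrow> (nat \<Rightarrow> 'a::comm_semiring_1) \<Rightarrow> 'a" where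
  "skew_schur lam mu n x = (\<Sum>T \<in> SSYT lam mu n. \<Prod>i = 1..n. x i ^ weight lam mu T i)"

definition principal_schur :: "(nat \<Rightarrow> nat) \<Rightarrow> (nat \<Rightarrow> nat) \<Rightarrow> nat \<Rightarrow> int poly" where
  "principal_schur lam mu n = skew_schur lam mu n (\<lambda>i. [:0, 1:] ^ (i - 1))"


section \<open>Crystal reflection operators\<close>

definition reading_boxes :: "(nat \<Rightarrow> nat) \<Rightarrow> (nat \<Rightarrow> nat) \<Rightarrow> (nat \<times> nat) list" where
  "reading_boxes lam mu =
     concat (map (\<lambda>i. map (\<lambda>j. (i, j)) [mu i..<lam i]) (rev [0..<partition_length lam]))"

text \<open>
  Scanning the reading word, \<open>us\<close> is the list of boxes with letter \<open>i\<close> or \<open>Suc i\<close> not yet matched.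
  A box with letter \<open>i\<close> (a closing parenthesis) cancels the last box of \<open>us\<close>
  if that one has letter \<open>Suc i\<close> (an opening parenthesis).
\<close>

definition match_step ::
    "nat \<Rightarrow> ('b \<Rightarrow> nat) \<Rightarrow> 'b \<Rightarrow> 'b list \<Rightarrow> 'b list" where
  "match_step i T b us =
     (if T b = Suc i then us @ [b]
      else if T b = i then
        (if us \<noteq> [] \<and> T (last us) = Suc i then butlast us else us @ [b])
      else us)"

definition unmatched :: "nat \<Rightarrow> ('b \<Rightarrow> nat) \<Rightarrow> 'b list \<Rightarrow> 'b list" where
  "unmatched i T bs = fold (match_step i T) bs []"

definition crystal_reflection ::
    "(nat \<Rightarrow> nat) \<Rightarrow> (nat \<Rightarrow> nat) \<Rightarrow> nat \<Rightarrow> (nat \<times> nat \<Rightarrow> nat) \<Rightarrow> (nat \<times> nat \<Rightarrow> nat)" where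
  "crystal_reflection lam mu i T =
     (let us = unmatched i T (reading_boxes lam mu);
          b = length (filter (\<lambda>c. T c = Suc i) us)
      in (\<lambda>c. if c \<in> set (take b us) then i
              else if c \<in> set (drop b us) then Suc i
              else T c))"


section \<open>The cyclic action\<close>

text \<open>In both folds the index 1 is applied first.\<close>

definition crystal_cycle ::
    "(nat \<Rightarrow> nat) \<Rightarrow> (nat \<Rightarrow> nat) \<Rightarrow> nat \<Rightarrow> (nat \<times> nat \<Rightarrow> nat) \<Rightarrow> (nat \<times> nat \<Rightarrow> nat)" where
  "crystal_cycle lam mu n T = fold (crystal_reflection lam mu) [1..<n] T"

definition cycle_perm :: "nat \<Rightarrow> nat \<Rightarrow> nat" where
  "cycle_perm n = fold (\<lambda>i p. transpose i (Suc i) \<circ> p) [1..<n] id"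

definition cycle_group :: "nat \<Rightarrow> (nat \<Rightarrow> nat) monoid" where
  "cycle_group n = subgroup_generated (sym_group n) {cycle_perm n}"

text \<open>
  The \<open>k\<close>-th power of the \<open>n\<close>-cycle acts as the \<open>k\<close>-th iterate of \<open>crystal_cycle\<close>.
  That this does not depend on \<open>k\<close> modulo \<open>n\<close> is part of the assertion
  \<open>group_action\<close> in \<open>cyclic_sieving\<close>.
\<close>

definition cycle_action ::
    "(nat \<Rightarrow> nat) \<Rightarrow> (nat \<Rightarrow> nat) \<Rightarrow> nat \<Rightarrow> (nat \<Rightarrow> nat) \<Rightarrow>
     (nat \<times> nat \<Rightarrow> nat) \<Rightarrow> (nat \<times> nat \<Rightarrow> nat)" where
  "cycle_action lam mu n \<sigma> =
     restrict (crystal_cycle lam mu n ^^ (LEAST k. cycle_perm n ^^ k = \<sigma>)) (SSYT lam mu n)"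

end

theory Submission
  imports Defs "HOL-Algebra.Multiplicative_Group"
begin

text \<open>
  Sieving for a cyclic group of order \<open>n\<close> prescribes how often each power of the generator has fixed
  points. Write \<open>N\<close> for the number of boxes. When \<open>N\<close> is prime to \<open>n\<close> the prescription is extreme:
  a power that is not the identity fixes nothing, and the polynomial vanishes at every \<open>n\<close>-th root
  of unity except \<open>1\<close>, where it counts all tableaux. Both statements come from one congruence.
  The operator \<open>c\<close> rotates the weight, so on the multiset of entries it acts by lowering each entry
  by one and turning each \<open>1\<close> into \<open>n\<close>; hence it changes the sum of the entries by \<open>-N\<close> modulo \<open>n\<close>
  (\<open>entry_sum_crystal_cycle\<close>). If \<open>c^k\<close> fixes a tableau, then \<open>n\<close> divides \<open>k N\<close> and so \<open>k\<close>
  (\<open>fixed_point_power\<close>). The principal specialization at \<open>x\<close> is a sum of powers of \<open>x\<close> whose exponents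
  are these entry sums minus \<open>N\<close>; reindexing it along the bijection \<open>c\<close> multiplies it by \<open>x^(-N)\<close>,
  which differs from \<open>1\<close> for an \<open>n\<close>-th root of unity \<open>x \<noteq> 1\<close> (\<open>sum_rank_root_of_unity\<close>).
  For a straight shape every exponent is at least \<open>n(\<lambda>)\<close>, and dividing by a power of \<open>q\<close> changes neither
  the value at \<open>1\<close> nor the zeros on the unit circle.

  The main work is to show that \<open>c\<close> generates an action of the group of order \<open>n\<close> at all, that is,
  \<open>c^n = 1\<close>. This holds for every Coxeter element of the symmetric group (\<open>coxeter_order\<close>) once
  the reflections are known to be involutions satisfying the commutation and braid relations.
  These relations are proved for arbitrary words: a tableau is determined by its reading word, and
  a crystal reflection acts on reading words by \<open>reflect_word\<close> (\<open>crystal_reflection_word\<close>).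
  The point of passing to words is that there the reflections commute with Knuth transformations.
  A Knuth transformation at a fixed position is an injective operation on words, so an identity
  between products of reflections holds for a word as soon as it holds for one word in its Knuth
  class. For the braid relation only the letters \<open>m, m+1, m+2\<close> matter; row insertion brings them
  into the reading word of a tableau with three rows (\<open>normal_form\<close>), which is described by six
  multiplicities. On these the two reflections are explicit piecewise linear maps, and the braid
  relation becomes an identity between such maps (\<open>braid_params\<close>).
\<close>

section \<open>Reflection of words\<close>

text \<open>
  A letter \<open>Suc i\<close> opens a parenthesis and a letter \<open>i\<close> closes one. The matching is computed by three
  counters that can be evaluated on a factor of a word without knowing the rest: \<open>opens i b w\<close> and
  \<open>closes i a b w\<close> count the open parentheses pending and the unmatched closing letters seen
  after reading \<open>w\<close>, if \<open>b\<close> and \<open>a\<close> are these numbers before \<open>w\<close>; \<open>demand i r w\<close>, computed from the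
  right, counts the closing letters of \<open>w\<close> and of its continuation that need a partner to the left of
  \<open>w\<close>, if the continuation alone has \<open>r\<close> of them.
\<close>

fun opens :: "nat \<Rightarrow> nat \<Rightarrow> nat list \<Rightarrow> nat" where
  "opens i b [] = b"
| "opens i b (x # w) = opens i (if x = Suc i then Suc b else if x = i then b - 1 else b) w"

fun closes :: "nat \<Rightarrow> nat \<Rightarrow> nat \<Rightarrow> nat list \<Rightarrow> nat" where
  "closes i a b [] = a"
| "closes i a b (x # w) = closes i (if x = i \<and> b = 0 then Suc a else a)
     (if x = Suc i then Suc b else if x = i then b - 1 else b) w"

fun demand :: "nat \<Rightarrow> nat \<Rightarrow> nat list \<Rightarrow> nat" where
  "demand i r [] = r"
| "demand i r (x # w) =
     (if x = Suc i then demand i r w - 1 else if x = i then Suc (demand i r w) else demand i r w)"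

text \<open>
  The effect of the reflection on a factor of a word. Unmatched letters form \<open>i^A (Suc i)^B\<close>, and
  the first \<open>B\<close> of them have to become \<open>i\<close>, the others \<open>Suc i\<close>. So each unmatched letter needs to
  know only its rank among the unmatched letters and the total \<open>B\<close>: an unmatched \<open>i\<close> has no
  pending parenthesis in front of it, and its rank is \<open>a\<close>; an unmatched \<open>Suc i\<close> is not demanded from
  the right, so nothing pending is matched later either, and its rank is \<open>a + b\<close>.
\<close>

fun reflect_from :: "nat \<Rightarrow> nat \<Rightarrow> nat \<Rightarrow> nat \<Rightarrow> nat \<Rightarrow> nat list \<Rightarrow> nat list" where
  "reflect_from i B r a b [] = []"
| "reflect_from i B r a b (x # w) =
     (if x = Suc i then (if demand i r w = 0 \<and> a + b < B then i else Suc i) # reflect_from i B r a (Suc b) w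
      else if x = i then
        (if b = 0 then (if B \<le> a then Suc i else i) # reflect_from i B r (Suc a) 0 w
         else i # reflect_from i B r a (b - 1) w)
      else x # reflect_from i B r a b w)"

definition reflect_word :: "nat \<Rightarrow> nat list \<Rightarrow> nat list" where
  "reflect_word i w = reflect_from i (opens i 0 w) 0 0 0 w"

lemma opens_append: "opens i b (u @ v) = opens i (opens i b u) v"
  by (induction u arbitrary: b) auto

lemma closes_append: "closes i a b (u @ v) = closes i (closes i a b u) (opens i b u) v"
  by (induction u arbitrary: a b) auto

lemma demand_append: "demand i r (u @ v) = demand i (demand i r v) u"
  by (induction u) auto

lemma reflect_from_append:
  "reflect_from i B r a b (u @ v) =
     reflect_from i B (demand i r v) a b u @ reflect_from i B r (closes i a b u) (opens i b u) v"
  by (induction u arbitrary: a b) (auto simp: demand_append)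

lemma length_reflect_from [simp]: "length (reflect_from i B r a b w) = length w"
  by (induction w arbitrary: a b) auto

section \<open>Knuth transformations commute with reflections\<close>

text \<open>
  A transformation of factors that is invisible from outside (it preserves the counters)
  and that commutes with the reflection of the factor itself. It can then be applied inside any word.
\<close>

definition local_move :: "nat \<Rightarrow> (nat list \<Rightarrow> nat list) \<Rightarrow> bool" where
  "local_move i g \<longleftrightarrow> (\<forall>t.
     (\<forall>b. opens i b (g t) = opens i b t) \<and>
     (\<forall>a b. closes i a b (g t) = closes i a b t) \<and>
     (\<forall>r. demand i r (g t) = demand i r t) \<and>
     (\<forall>B r a b. reflect_from i B r a b (g t) = g (reflect_from i B r a b t)))"

definition apply_at :: "nat \<Rightarrow> nat \<Rightarrow> (nat list \<Rightarrow> nat list) \<Rightarrow> nat list \<Rightarrow> nat list" where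
  "apply_at p k g w = take p w @ g (take k (drop p w)) @ drop k (drop p w)"

lemma reflect_word_apply_at:
  assumes g: "local_move i g"
  shows "reflect_word i (apply_at p k g w) = apply_at p k g (reflect_word i w)"
proof -
  define u t v where "u = take p w" and "t = take k (drop p w)" and "v = drop k (drop p w)"
  have w: "w = u @ t @ v" by (metis append_take_drop_id u_def t_def v_def)
  have R: "apply_at p k g (u' @ t' @ v') = u' @ g t' @ v'"
    if "length u' = length u" "length t' = length t" "length v' = length v" for u' t' v' :: "nat list"
  proof -
    have "length u' = min p (length w)" "length t' = min k (length w - p)"
      "length v' = length w - p - k"
      using that by (auto simp: u_def t_def v_def)
    then show ?thesis
      by (cases "p \<le> length w"; cases "k \<le> length w - p") (auto simp: apply_at_def)
  qed
  have L: "apply_at p k g w = u @ g t @ v" by (simp add: apply_at_def u_def t_def v_def)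
  have B: "opens i b (g t) = opens i b t" "closes i a b (g t) = closes i a b t"
    "demand i r (g t) = demand i r t"
    "reflect_from i B r a b (g t) = g (reflect_from i B r a b t)" for B r a b
    using g by (auto simp: local_move_def)
  show ?thesis unfolding L
    unfolding w reflect_word_def
    by (simp add: reflect_from_append demand_append opens_append closes_append B R)
qed

text \<open>
  The four elementary Knuth transformations \<open>yzx \<longleftrightarrow> yxz\<close> for \<open>x < y \<le> z\<close> and \<open>xzy \<longleftrightarrow> zxy\<close> for
  \<open>x \<le> y < z\<close>, as one involution on words of length three. A reflection may
  turn an instance of one pair into an instance of the other, so only their union commutes with it.
\<close>

fun knuth_swap :: "nat list \<Rightarrow> nat list" where
  "knuth_swap [x, y, z] =
     (if z < x \<and> x \<le> y \<or> y < x \<and> x \<le> z then [x, z, y]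
      else if x \<le> z \<and> z < y \<or> y \<le> z \<and> z < x then [y, x, z] else [x, y, z])"
| "knuth_swap t = t"

definition foreign :: "nat \<Rightarrow> nat \<Rightarrow> bool" where
  "foreign m x \<longleftrightarrow> x \<noteq> m \<and> x \<noteq> Suc m \<and> x \<noteq> Suc (Suc m)"

text \<open>
  The relations between two neighbouring reflections involve three letters only, so all others may
  be moved out of the way.
\<close>

fun foreign_swap :: "nat \<Rightarrow> nat list \<Rightarrow> nat list" where
  "foreign_swap m [x, y] = (if foreign m x \<noteq> foreign m y then [y, x] else [x, y])"
| "foreign_swap m t = t"

lemma knuth_swap_id: "length t \<noteq> 3 \<Longrightarrow> knuth_swap t = t"
  by (cases t rule: knuth_swap.cases) auto

lemma foreign_swap_id: "length t \<noteq> 2 \<Longrightarrow> foreign_swap m t = t"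
  by (cases "(m, t)" rule: foreign_swap.cases) auto

lemma local_move_knuth: "local_move i knuth_swap"
proof -
  have "opens i b (knuth_swap t) = opens i b t \<and> closes i a b (knuth_swap t) = closes i a b t \<and>
    demand i r (knuth_swap t) = demand i r t \<and>
    reflect_from i B r a b (knuth_swap t) = knuth_swap (reflect_from i B r a b t)" for B r a b t
  proof (cases "length t = 3")
    case False
    then show ?thesis by (simp add: knuth_swap_id)
  next
    case True
    then obtain x y z where 1: "t = [x, y, z]"
      by (auto simp: numeral_3_eq_3 length_Suc_conv)
    have x: "x < i \<or> x = i \<or> x = Suc i \<or> x > Suc i"
      and y: "y < i \<or> y = i \<or> y = Suc i \<or> y > Suc i"
      and z: "z < i \<or> z = i \<or> z = Suc i \<or> z > Suc i" by linarith+
    have "opens i b (knuth_swap [x, y, z]) = opens i b [x, y, z] \<and>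
        closes i a b (knuth_swap [x, y, z]) = closes i a b [x, y, z] \<and>
        demand i r (knuth_swap [x, y, z]) = demand i r [x, y, z]"
      using x y z by (elim disjE) auto
    moreover have "reflect_from i B r a b (knuth_swap [x, y, z]) =
        knuth_swap (reflect_from i B r a b [x, y, z])" (is ?R)
    proof -
      have ?R if "x = i \<or> x = Suc i" "y = i \<or> y = Suc i" "z = i \<or> z = Suc i"
        using that by (elim disjE) auto
      moreover have ?R if "x < i \<or> x > Suc i"
        using that y z by (elim disjE) simp_all
      moreover have ?R if "x = i \<or> x = Suc i" "y < i \<or> y > Suc i"
        using that z by (elim disjE) simp_all
      moreover have ?R if "x = i \<or> x = Suc i" "y = i \<or> y = Suc i" "z < i \<or> z > Suc i"
        using that by (elim disjE) simp_all
      ultimately show ?R using x y z by blast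
    qed
    ultimately show ?thesis unfolding 1 by blast
  qed
  then show ?thesis unfolding local_move_def by blast
qed

lemma foreign_reflect_from:
  assumes "i = m \<or> i = Suc m"
  shows "map (foreign m) (reflect_from i B r a b w) = map (foreign m) w"
  using assms by (induction w arbitrary: a b) (auto simp: foreign_def)

lemma local_move_foreign:
  assumes "i = m \<or> i = Suc m"
  shows "local_move i (foreign_swap m)"
proof -
  have "opens i b (foreign_swap m t) = opens i b t \<and> closes i a b (foreign_swap m t) = closes i a b t \<and>
    demand i r (foreign_swap m t) = demand i r t \<and>
    reflect_from i B r a b (foreign_swap m t) = foreign_swap m (reflect_from i B r a b t)" for B r a b t
  proof (cases "length t = 2")
    case False
    then show ?thesis by (simp add: foreign_swap_id)
  next
    case True
    then obtain x y where t: "t = [x, y]"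
      by (auto simp: numeral_2_eq_2 length_Suc_conv)
    have neutral: "demand i r [z] = r" "closes i a b [z] = a" "opens i b [z] = b"
      "reflect_from i B r a b [z] = [z]"
      if "foreign m z" for r a b z
      using that assms by (auto simp: foreign_def)
    note [simp del] = opens.simps closes.simps demand.simps reflect_from.simps
    have commute: "opens i b [z, w] = opens i b [w, z]" "closes i a b [z, w] = closes i a b [w, z]"
      "demand i r [z, w] = demand i r [w, z]"
      "\<exists>w'. \<not> foreign m w' \<and> reflect_from i B r a b [w, z] = [w', z] \<and> reflect_from i B r a b [z, w] = [z, w']"
      if "foreign m z" "\<not> foreign m w" for z w
    proof -
      obtain w' where w': "reflect_from i B r a b [w] = [w']"
        using length_reflect_from[of i B r a b "[w]"] by (metis length_0_conv length_Suc_conv)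
      then have "\<not> foreign m w'"
        using foreign_reflect_from[OF assms, of B r a b "[w]"] that by simp
      then show "\<exists>w'. \<not> foreign m w' \<and> reflect_from i B r a b [w, z] = [w', z] \<and> reflect_from i B r a b [z, w] = [z, w']"
        using reflect_from_append[of i B r a b "[w]" "[z]"] reflect_from_append[of i B r a b "[z]" "[w]"]
          neutral[OF \<open>foreign m z\<close>] w' by (auto intro!: exI[of _ w'])
    qed (use opens_append[of i b "[w]" "[z]"] opens_append[of i b "[z]" "[w]"]
          closes_append[of i a b "[w]" "[z]"] closes_append[of i a b "[z]" "[w]"]
          demand_append[of i r "[w]" "[z]"] demand_append[of i r "[z]" "[w]"]
          neutral[OF \<open>foreign m z\<close>] in simp_all)
    consider "foreign m x = foreign m y" | "foreign m x" "\<not> foreign m y" | "\<not> foreign m x" "foreign m y"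
      by blast
    then show ?thesis
    proof cases
      case 1
      obtain x' y' where r: "reflect_from i B r a b t = [x', y']"
        using length_reflect_from[of i B r a b t] by (auto simp: t length_Suc_conv simp del: length_reflect_from)
      have "foreign m x' = foreign m x" "foreign m y' = foreign m y"
        using foreign_reflect_from[OF assms, of B r a b t] r t by simp_all
      then show ?thesis using 1 r by (simp add: t)
    next
      case 2
      then show ?thesis using commute[of x y]
        by (auto simp: t)
    next
      case 3
      then show ?thesis using commute[of y x]
        by (auto simp: t)
    qed
  qed
  then show ?thesis unfolding local_move_def by blast
qed

section \<open>Classes of words\<close>

text \<open>
  The map \<open>h\<close> stands for a composition of Knuth transformations at fixed positions. Its injectivity is
  what allows identities between products of reflections to be pulled back from \<open>w'\<close> to \<open>w\<close>.
\<close>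

definition plactic :: "nat \<Rightarrow> nat list \<Rightarrow> nat list \<Rightarrow> bool" where
  "plactic m w w' \<longleftrightarrow> (\<exists>h. inj h \<and> h w = w' \<and> (\<forall>v. mset (h v) = mset v) \<and>
     (\<forall>i v. i = m \<or> i = Suc m \<longrightarrow> reflect_word i (h v) = h (reflect_word i v)))"

lemma plactic_refl: "plactic m w w"
  unfolding plactic_def by (rule exI[of _ id]) auto

lemma plactic_trans [trans]:
  assumes "plactic m w w'" and "plactic m w' w''"
  shows "plactic m w w''"
proof -
  obtain h h' where "inj h" "h w = w'" "\<forall>v. mset (h v) = mset v" "inj h'" "h' w' = w''" "\<forall>v. mset (h' v) = mset v"
    "\<forall>i v. i = m \<or> i = Suc m \<longrightarrow> reflect_word i (h v) = h (reflect_word i v)"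
    "\<forall>i v. i = m \<or> i = Suc m \<longrightarrow> reflect_word i (h' v) = h' (reflect_word i v)"
    using assms unfolding plactic_def by blast
  then show ?thesis unfolding plactic_def
    by (intro exI[of _ "h' \<circ> h"]) (auto simp: inj_compose)
qed

lemma plactic_apply_at:
  assumes g: "\<And>i. i = m \<or> i = Suc m \<Longrightarrow> local_move i g"
    and inv: "\<And>t. g (g t) = t" and ms: "\<And>t. mset (g t) = mset t"
  shows "plactic m (u @ t @ v) (u @ g t @ v)"
proof -
  \<comment> \<open>The position is that of the factor \<open>t\<close>, but \<open>?h\<close> is defined on all words.\<close>
  let ?h = "apply_at (length u) (length t) g"
  have len: "length (g s) = length s" for s
    using ms[of s] by (metis size_mset)
  have nil: "g [] = []"
    using len[of "[]"] by (metis length_0_conv)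
  have hh: "?h (?h w) = w" for w
    by (cases "length u \<le> length w"; cases "length t \<le> length w - length u")
      (auto simp: apply_at_def len nil inv min_def simp flip: drop_drop)
  have "inj ?h" by (metis hh injI)
  moreover have "?h (u @ t @ v) = u @ g t @ v" by (simp add: apply_at_def)
  moreover have "mset (?h w) = mset w" for w
  proof -
    have "mset (?h w) = mset (take (length u) w) + mset (take (length t) (drop (length u) w))
       + mset (drop (length t) (drop (length u) w))"
      by (simp add: apply_at_def ms)
    also have "\<dots> = mset w"
      by (metis append_take_drop_id mset_append add.assoc)
    finally show ?thesis .
  qed
  ultimately show ?thesis
    unfolding plactic_def using g by (intro exI[of _ ?h]) (auto simp: reflect_word_apply_at)
qed

lemma plactic_knuth: "plactic m (u @ t @ v) (u @ knuth_swap t @ v)"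
proof (rule plactic_apply_at)
  show "knuth_swap (knuth_swap t) = t" for t
    by (cases t rule: knuth_swap.cases) auto
  show "mset (knuth_swap t) = mset t" for t
    by (cases t rule: knuth_swap.cases) auto
qed (rule local_move_knuth)

lemma plactic_foreign: "plactic m (u @ t @ v) (u @ foreign_swap m t @ v)"
proof (rule plactic_apply_at)
  show "foreign_swap m (foreign_swap m t) = t" for t
    by (cases "(m, t)" rule: foreign_swap.cases) auto
  show "mset (foreign_swap m t) = mset t" for t
    by (cases "(m, t)" rule: foreign_swap.cases) auto
qed (rule local_move_foreign)

text \<open>
  Schensted insertion: \<open>x\<close> travels left through the larger letters \<open>zs\<close> until it meets the letter \<open>y\<close>
  that it bumps, and \<open>y\<close> then travels left through the letters \<open>ps\<close>.
\<close>

lemma row_insertion: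
  assumes "sorted (ps @ y # zs)" "sorted (ps @ [x])" "x < y"
  shows "plactic m (u @ ps @ y # zs @ x # v) (u @ y # ps @ x # zs @ v)"
proof -
  have "sorted (y # zs)" using assms(1) by (simp add: sorted_append)
  then have "plactic m (u @ y # zs @ x # v) (u @ y # x # zs @ v)" for u v
    using \<open>x < y\<close>
  proof (induction zs arbitrary: v rule: rev_induct)
    case Nil
    then show ?case by (simp add: plactic_refl)
  next
    case (snoc z zs)
    define p where "p = last (y # zs)"
    define qs where "qs = butlast (y # zs)"
    have yzs: "y # zs = qs @ [p]" by (simp add: p_def qs_def)
    have "sorted ((qs @ [p]) @ [z])" using snoc.prems by (simp flip: yzs)
    then have "p \<le> z" by (simp add: sorted_append)
    have "y \<le> p" using snoc.prems by (auto simp: p_def sorted_append)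
    then have k: "knuth_swap [p, z, x] = [p, x, z]" using \<open>x < y\<close> \<open>p \<le> z\<close> by simp
    have "plactic m ((u @ qs) @ [p, z, x] @ v) ((u @ qs) @ knuth_swap [p, z, x] @ v)"
      by (rule plactic_knuth)
    then have "plactic m (u @ (qs @ [p]) @ z # x # v) (u @ (qs @ [p]) @ x # z # v)"
      by (simp add: k del: knuth_swap.simps)
    then have "plactic m (u @ y # (zs @ [z]) @ x # v) (u @ y # zs @ x # (z # v))"
      by (simp flip: yzs)
    also have "plactic m \<dots> (u @ y # x # zs @ z # v)"
      using snoc by (simp add: sorted_append)
    finally show ?case by simp
  qed
  from this[of "u @ ps" v]
  have "plactic m ((u @ ps) @ y # zs @ x # v) ((u @ ps) @ y # x # zs @ v)" .
  also have "plactic m ((u @ ps) @ y # x # zs @ v) (u @ y # ps @ x # zs @ v)"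
    using assms(2,3)
  proof (induction ps arbitrary: x zs rule: rev_induct)
    case Nil
    then show ?case by (simp add: plactic_refl)
  next
    case (snoc p ps)
    have px: "p \<le> x" using snoc.prems by (simp add: sorted_append)
    then have k: "knuth_swap [p, y, x] = [y, p, x]" using snoc.prems by simp
    have "plactic m ((u @ ps) @ [p, y, x] @ zs @ v) ((u @ ps) @ knuth_swap [p, y, x] @ zs @ v)"
      by (rule plactic_knuth)
    then have "plactic m ((u @ ps @ [p]) @ y # x # zs @ v) ((u @ ps) @ y # p # (x # zs) @ v)"
      by (simp add: k del: knuth_swap.simps)
    also have "plactic m \<dots> (u @ y # ps @ p # (x # zs) @ v)"
      by (rule snoc.IH) (use snoc.prems px in \<open>auto simp: sorted_append\<close>)
    finally show ?case by simp
  qed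
  finally show ?thesis by simp
qed

lemma move_left_of_foreign:
  assumes "\<forall>z \<in> set zs. foreign m z" "\<not> foreign m x"
  shows "plactic m (u @ zs @ x # v) (u @ x # zs @ v)"
  using assms
proof (induction zs arbitrary: v rule: rev_induct)
  case Nil
  then show ?case by (simp add: plactic_refl)
next
  case (snoc z zs)
  have "plactic m ((u @ zs) @ [z, x] @ v) ((u @ zs) @ foreign_swap m [z, x] @ v)"
    by (rule plactic_foreign)
  then have "plactic m (u @ (zs @ [z]) @ x # v) (u @ zs @ x # (z # v))"
    using snoc.prems by simp
  also have "plactic m \<dots> (u @ x # zs @ z # v)"
    using snoc by simp
  finally show ?case by simp
qed

section \<open>Normal forms by row insertion\<close>

text \<open>
  The reading word, from the bottom row to the top row, of a tableau with letters \<open>m, m+1, m+2\<close>. The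
  condition on columns is \<open>tableau_params\<close>; there is none on \<open>c\<close>.
\<close>

definition three_rows :: "nat \<Rightarrow> nat \<Rightarrow> nat \<Rightarrow> nat \<Rightarrow> nat \<Rightarrow> nat \<Rightarrow> nat \<Rightarrow> nat list" where
  "three_rows m f d e a b c =
     replicate f (Suc (Suc m)) @ (replicate d (Suc m) @ replicate e (Suc (Suc m))) @
     (replicate a m @ replicate b (Suc m) @ replicate c (Suc (Suc m)))"

definition tableau_params :: "nat \<Rightarrow> nat \<Rightarrow> nat \<Rightarrow> nat \<Rightarrow> nat \<Rightarrow> bool" where
  "tableau_params f d e a b \<longleftrightarrow> f \<le> d \<and> d \<le> a \<and> d + e \<le> a + b"

text \<open>
  Each insertion into the top row bumps at most one letter into the second row, and that one at most
  one letter into the bottom row, which consists of the largest letter only, so that nothing is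
  bumped out of it.
\<close>

lemma insert_letter:
  assumes t: "tableau_params f d e a b" and x: "\<not> foreign m x"
  shows "\<exists>f' d' e' a' b' c'. tableau_params f' d' e' a' b' \<and>
    (\<forall>v. plactic m (three_rows m f d e a b c @ x # v) (three_rows m f' d' e' a' b' c' @ v))"
proof -
  let ?f = "replicate f (Suc (Suc m))" and ?d = "replicate d (Suc m)" and ?e = "replicate e (Suc (Suc m))"
  \<comment> \<open>A letter \<open>Suc m\<close> arriving in the second row bumps its first \<open>Suc (Suc m)\<close>, if there is one.\<close>
  have into_second: "plactic m (?f @ ?d @ ?e @ Suc m # v)
      (replicate (if e = 0 then f else Suc f) (Suc (Suc m)) @ replicate (Suc d) (Suc m) @ replicate (e - 1) (Suc (Suc m)) @ v)" for v
  proof (cases e)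
    case 0
    then show ?thesis by (simp add: plactic_refl replicate_app_Cons_same)
  next
    case (Suc e')
    have "plactic m (?f @ ?d @ Suc (Suc m) # replicate e' (Suc (Suc m)) @ Suc m # v)
        (?f @ Suc (Suc m) # ?d @ Suc m # replicate e' (Suc (Suc m)) @ v)"
      by (rule row_insertion) (auto simp: sorted_append)
    then show ?thesis using Suc by (simp add: replicate_app_Cons_same)
  qed
  consider "x = Suc (Suc m)" | "x = Suc m" "c = 0" | c' where "x = Suc m" "c = Suc c'"
    | "x = m" "b = 0" "c = 0" | c' where "x = m" "b = 0" "c = Suc c'" | b' where "x = m" "b = Suc b'"
    using x by (cases b; cases c) (auto simp: foreign_def)
  then show ?thesis
  proof cases
    case 1
    then have "plactic m (three_rows m f d e a b c @ x # v) (three_rows m f d e a b (Suc c) @ v)" for v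
      using 1 by (auto simp: three_rows_def plactic_refl replicate_app_Cons_same)
    moreover have "tableau_params f d e a b"
      using t 1 by (auto simp: tableau_params_def)
    ultimately show ?thesis by blast
  next
    case 2
    then have "plactic m (three_rows m f d e a b c @ x # v) (three_rows m f d e a (Suc b) 0 @ v)" for v
      using 2 by (auto simp: three_rows_def plactic_refl replicate_app_Cons_same)
    moreover have "tableau_params f d e a (Suc b)"
      using t 2 by (auto simp: tableau_params_def)
    ultimately show ?thesis by blast
  next
    case (3 c')
    have "plactic m ((?f @ ?d @ ?e) @ (replicate a m @ replicate b (Suc m)) @ Suc (Suc m) # replicate c' (Suc (Suc m)) @ Suc m # v)
       ((?f @ ?d @ ?e) @ Suc (Suc m) # (replicate a m @ replicate b (Suc m)) @ Suc m # replicate c' (Suc (Suc m)) @ v)" for v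
      by (rule row_insertion) (auto simp: sorted_append)
    then have "plactic m (three_rows m f d e a b c @ x # v) (three_rows m f d (Suc e) a (Suc b) c' @ v)" for v
      using 3 by (auto simp: three_rows_def plactic_refl replicate_app_Cons_same)
    moreover have "tableau_params f d (Suc e) a (Suc b)"
      using t 3 by (auto simp: tableau_params_def)
    ultimately show ?thesis by blast
  next
    case 4
    then have "plactic m (three_rows m f d e a b c @ x # v) (three_rows m f d e (Suc a) 0 0 @ v)" for v
      using 4 by (auto simp: three_rows_def plactic_refl replicate_app_Cons_same)
    moreover have "tableau_params f d e (Suc a) 0"
      using t 4 by (auto simp: tableau_params_def)
    ultimately show ?thesis by blast
  next
    case (5 c')
    have "plactic m ((?f @ ?d @ ?e) @ replicate a m @ Suc (Suc m) # replicate c' (Suc (Suc m)) @ m # v)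
       ((?f @ ?d @ ?e) @ Suc (Suc m) # replicate a m @ m # replicate c' (Suc (Suc m)) @ v)" for v
      by (rule row_insertion) (auto simp: sorted_append)
    then have "plactic m (three_rows m f d e a b c @ x # v) (three_rows m f d (Suc e) (Suc a) 0 c' @ v)" for v
      using 5 by (auto simp: three_rows_def plactic_refl replicate_app_Cons_same)
    moreover have "tableau_params f d (Suc e) (Suc a) 0"
      using t 5 by (auto simp: tableau_params_def)
    ultimately show ?thesis by blast
  next
    case (6 b')
    have "plactic m (three_rows m f d e a b c @ x # v)
      (three_rows m (if e = 0 then f else Suc f) (Suc d) (e - 1) (Suc a) b' c @ v)" for v
    proof -
      have "plactic m ((?f @ ?d @ ?e) @ replicate a m @ Suc m # (replicate b' (Suc m) @ replicate c (Suc (Suc m))) @ m # v)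
         ((?f @ ?d @ ?e) @ Suc m # replicate a m @ m # (replicate b' (Suc m) @ replicate c (Suc (Suc m))) @ v)"
        by (rule row_insertion) (auto simp: sorted_append)
      then have "plactic m (three_rows m f d e a b c @ x # v)
         (?f @ ?d @ ?e @ Suc m # replicate a m @ m # (replicate b' (Suc m) @ replicate c (Suc (Suc m))) @ v)"
        using 6 by (simp add: three_rows_def)
      also note into_second
      finally show ?thesis by (simp add: three_rows_def replicate_app_Cons_same)
    qed
    moreover have "tableau_params (if e = 0 then f else Suc f) (Suc d) (e - 1) (Suc a) b'"
      using t 6 by (auto simp: tableau_params_def)
    ultimately show ?thesis by blast
  qed
qed

text \<open>
  The statement proved by induction carries an arbitrary continuation \<open>v\<close>, because a witness for
  \<open>w\<close> says nothing about \<open>w @ v\<close>.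
\<close>

lemma normal_form:
  obtains f d e a b c rest where "tableau_params f d e a b" "\<forall>z \<in> set rest. foreign m z"
    "plactic m w (three_rows m f d e a b c @ rest)"
proof -
  have "\<exists>f d e a b c rest. tableau_params f d e a b \<and> (\<forall>z \<in> set rest. foreign m z) \<and>
    (\<forall>v. plactic m (w @ v) (three_rows m f d e a b c @ rest @ v))"
  proof (induction w rule: rev_induct)
    case Nil
    show ?case
    proof -
      have "tableau_params 0 0 0 0 0" "\<forall>z\<in>set []. foreign m z"
        "\<And>v. plactic m ([] @ v) (three_rows m 0 0 0 0 0 0 @ [] @ v)"
        by (auto simp: tableau_params_def three_rows_def plactic_refl)
      then show ?thesis by blast
    qed
  next
    case (snoc x w)
    then obtain f d e a b c rest where t: "tableau_params f d e a b" and r: "\<forall>z \<in> set rest. foreign m z"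
      and w: "\<And>v. plactic m (w @ v) (three_rows m f d e a b c @ rest @ v)" by blast
    show ?case
    proof (cases "foreign m x")
      case True
      have "\<forall>z\<in>set (rest @ [x]). foreign m z" using r True by simp
      moreover have "plactic m ((w @ [x]) @ v) (three_rows m f d e a b c @ (rest @ [x]) @ v)" for v
        using w[of "x # v"] by simp
      ultimately show ?thesis using t by blast
    next
      case False
      from insert_letter[OF t this, of c]
      obtain f' d' e' a' b' c' where t': "tableau_params f' d' e' a' b'"
        and i: "\<And>v. plactic m (three_rows m f d e a b c @ x # v) (three_rows m f' d' e' a' b' c' @ v)"
        by blast
      have "plactic m ((w @ [x]) @ v) (three_rows m f' d' e' a' b' c' @ rest @ v)" for v
      proof -
        have "plactic m ((w @ [x]) @ v) (three_rows m f d e a b c @ rest @ x # v)"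
          using w[of "x # v"] by simp
        also have "plactic m \<dots> (three_rows m f d e a b c @ x # rest @ v)"
          using move_left_of_foreign[OF r False] .
        also note i
        finally show ?thesis .
      qed
      then show ?thesis using t' r by blast
    qed
  qed
  then show ?thesis using that by (metis append_Nil2)
qed

section \<open>Reflections of normal forms\<close>

lemma counters_replicate:
  "opens i b (replicate k i) = b - k" "opens i b (replicate k (Suc i)) = b + k"
  "closes i a b (replicate k i) = a + (k - b)" "closes i a b (replicate k (Suc i)) = a"
  "demand i r (replicate k i) = r + k" "demand i r (replicate k (Suc i)) = r - k"
proof -
  show "opens i b (replicate k i) = b - k" by (induction k arbitrary: b) auto
  show "opens i b (replicate k (Suc i)) = b + k" by (induction k arbitrary: b) auto
  show "closes i a b (replicate k i) = a + (k - b)"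
    by (induction k arbitrary: a b) auto
  show "closes i a b (replicate k (Suc i)) = a" by (induction k arbitrary: a b) auto
  show "demand i r (replicate k i) = r + k" by (induction k) auto
  show "demand i r (replicate k (Suc i)) = r - k" by (induction k) auto
qed

text \<open>
  Since ranks increase along a block of equal letters, a reflection cuts the block into two.
\<close>

lemma reflect_from_replicate:
  "reflect_from i B r a b (replicate k i) =
     replicate (min k (b + (B - a))) i @ replicate (k - (b + (B - a))) (Suc i)"
  "reflect_from i B r a b (replicate k (Suc i)) =
     replicate (min (k - r) (B - (a + b))) i @ replicate (k - min (k - r) (B - (a + b))) (Suc i)"
proof -
  show "reflect_from i B r a b (replicate k i) =
     replicate (min k (b + (B - a))) i @ replicate (k - (b + (B - a))) (Suc i)"
  proof (induction k arbitrary: a b)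
    case (Suc k)
    show ?case
    proof (cases "b + (B - a)")
      case 0
      then show ?thesis using Suc[of "Suc a" 0] by simp
    next
      case (Suc t)
      then have "b = 0 \<Longrightarrow> B - Suc a = t" "b \<noteq> 0 \<Longrightarrow> b - 1 + (B - a) = t" "b = 0 \<Longrightarrow> \<not> B \<le> a"
        by linarith+
      then show ?thesis using Suc.IH[of "Suc a" 0] Suc.IH[of a "b - 1"] Suc
        by (cases "b = 0") simp_all
    qed
  qed simp
  show "reflect_from i B r a b (replicate k (Suc i)) =
     replicate (min (k - r) (B - (a + b))) i @ replicate (k - min (k - r) (B - (a + b))) (Suc i)"
  proof (induction k arbitrary: b)
    case (Suc k)
    show ?case
    proof (cases "min (Suc k - r) (B - (a + b))")
      case 0
      then have "\<not> (r - k = 0 \<and> a + b < B)" "min (k - r) (B - (a + Suc b)) = 0"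
        by (auto simp: min_def split: if_splits)
      then show ?thesis using 0 Suc[of "Suc b"] by (simp add: counters_replicate)
    next
      case (Suc t)
      then have "r - k = 0" "a + b < B" "min (k - r) (B - (a + Suc b)) = t"
        by (auto simp: min_def split: if_splits)
      then show ?thesis using Suc Suc.IH[of "Suc b"] by (simp add: counters_replicate)
    qed
  qed simp
qed

lemma neutral_letters:
  assumes "i \<notin> set w" "Suc i \<notin> set w"
  shows "opens i b w = b" "closes i a b w = a" "demand i r w = r" "reflect_from i B r a b w = w"
  using assms by (induction w arbitrary: a b) auto

lemma merge_replicates:
  assumes "j = 0 \<or> k = 0" "p = i + k" "q = j + l"
  shows "replicate i x @ replicate j y @ replicate k x @ replicate l y = replicate p x @ replicate q y"
  using assms by (auto simp: replicate_add)

text \<open>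
  The \<open>d\<close> letters \<open>Suc m\<close> of the second row are matched with letters \<open>m\<close> of the top row. What remains
  unmatched lies in the top row, and there \<open>m^(a-d) (Suc m)^b\<close> becomes \<open>m^b (Suc m)^(a-d)\<close>.
\<close>

lemma reflect_lower:
  assumes t: "tableau_params f d e a b" and r: "\<forall>z \<in> set rest. foreign m z"
  shows "reflect_word m (three_rows m f d e a b c @ rest) = three_rows m f d e (b + d) (a - d) c @ rest"
proof -
  have n: "m \<notin> set (replicate k (Suc (Suc m)))" "Suc m \<notin> set (replicate k (Suc (Suc m)))"
     "m \<notin> set rest" "Suc m \<notin> set rest" for k
    using r by (auto simp: foreign_def)
  have da: "d \<le> a" using t by (simp add: tableau_params_def)
  note [simp] = reflect_from_append opens_append closes_append demand_append
      reflect_from_replicate counters_replicate neutral_letters[OF n(1,2)] neutral_letters[OF n(3,4)]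
  have m: "replicate (min a (d + b)) m @ replicate (a - (d + b)) (Suc m) @
    replicate (min b (b - (a - d))) m @ replicate (b - min b (b - (a - d))) (Suc m) =
    replicate (b + d) m @ replicate (a - d) (Suc m)"
    by (rule merge_replicates) (use da in auto)
  show ?thesis
    unfolding reflect_word_def three_rows_def using da m by simp
qed

text \<open>
  The bottom row is matched with letters \<open>Suc m\<close> of the second row, and as many letters
  \<open>Suc (Suc m)\<close> of the second row as possible with letters \<open>Suc m\<close> of the top row. Here \<open>B\<close> counts the
  unmatched letters \<open>Suc (Suc m)\<close>, and \<open>X\<close> the unmatched letters that lie in the second row. These
  \<open>X\<close> places are read first, so \<open>min B X\<close> of them receive the letter \<open>Suc m\<close>.
\<close>

lemma reflect_upper:
  fixes f d e a b c :: nat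
  defines "B \<equiv> (e - b) + c" and "X \<equiv> (d - f) + (e - b)"
  assumes t: "tableau_params f d e a b" and r: "\<forall>z \<in> set rest. foreign m z"
  shows "reflect_word (Suc m) (three_rows m f d e a b c @ rest) =
    three_rows m f (f + min B X) (d + e - (f + min B X)) a (min e b + (B - X)) (b + c - (min e b + (B - X))) @ rest"
proof -
  have n: "Suc m \<notin> set (replicate k m)" "Suc (Suc m) \<notin> set (replicate k m)"
     "Suc m \<notin> set rest" "Suc (Suc m) \<notin> set rest" for k
    using r by (auto simp: foreign_def)
  have fd: "f \<le> d" "f \<le> b - e + d" using t by (auto simp: tableau_params_def)
  note [simp] = reflect_from_append opens_append closes_append demand_append
      reflect_from_replicate counters_replicate neutral_letters[OF n(1,2)] neutral_letters[OF n(3,4)]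
  have m2: "replicate (min d (f + B)) (Suc m) @ replicate (d - (f + B)) (Suc (Suc m)) @
    replicate (min (e - b) (B - (d - f))) (Suc m) @ replicate (e - min (e - b) (B - (d - f))) (Suc (Suc m)) =
    replicate (f + min B X) (Suc m) @ replicate (d + e - (f + min B X)) (Suc (Suc m))"
    by (rule merge_replicates) (use fd in \<open>auto simp: X_def\<close>)
  have m1: "replicate (min b (e + (B - (d - f)))) (Suc m) @ replicate (b - (e + (B - (d - f)))) (Suc (Suc m)) @
    replicate (min c (B - (d - f + (b - e) + (e - b)))) (Suc m) @ replicate (c - min c (B - (d - f + (b - e) + (e - b)))) (Suc (Suc m)) =
    replicate (min e b + (B - X)) (Suc m) @ replicate (b + c - (min e b + (B - X))) (Suc (Suc m))"
    by (rule merge_replicates) (use fd in \<open>auto simp: X_def B_def\<close>)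
  have B: "opens (Suc m) 0 (three_rows m f d e a b c @ rest) = B"
    using fd by (simp add: three_rows_def B_def)
  show ?thesis
    unfolding reflect_word_def B unfolding three_rows_def using fd m1 m2 by simp
qed

type_synonym params = "nat \<times> nat \<times> nat \<times> nat \<times> nat \<times> nat"

text \<open>
  The maps of \<open>reflect_lower\<close> and \<open>reflect_upper\<close> on the six multiplicities.
\<close>

fun lower_params :: "params \<Rightarrow> params" where
  "lower_params (f, d, e, a, b, c) = (f, d, e, b + d, a - d, c)"

fun upper_params :: "params \<Rightarrow> params" where
  "upper_params (f, d, e, a, b, c) =
     (let B = (e - b) + c; X = (d - f) + (e - b); d' = f + min B X; b' = min e b + (B - X)
      in (f, d', d + e - d', a, b', b + c - b'))"

lemma valid_lower:
  assumes "tableau_params f d e a b" "lower_params (f, d, e, a, b, c) = (f', d', e', a', b', c')"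
  shows "tableau_params f' d' e' a' b'"
  using assms by (auto simp: tableau_params_def)

lemma valid_upper:
  assumes "tableau_params f d e a b" "upper_params (f, d, e, a, b, c) = (f', d', e', a', b', c')"
  shows "tableau_params f' d' e' a' b'"
  using assms by (auto simp: tableau_params_def Let_def min_def split: if_splits)

text \<open>
  With the inequalities parametrised by their slacks and the sign of \<open>e - b\<close> fixed, resolving
  the minima leaves linear arithmetic in every case.
\<close>

lemma braid_params:
  assumes "tableau_params f d e a b"
  shows "lower_params (upper_params (lower_params (f, d, e, a, b, c))) =
    upper_params (lower_params (upper_params (f, d, e, a, b, c)))"
proof -
  obtain p where p: "d = f + p" using assms by (auto simp: tableau_params_def le_iff_add)
  obtain s where s: "a = d + s" using assms by (auto simp: tableau_params_def le_iff_add)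
  have e: "e \<le> s + b" using assms p s by (auto simp: tableau_params_def)
  consider (be) k where "b = e + k" | (eb) k where "e = b + k" by (metis le_iff_add nle_le)
  then show ?thesis
  proof cases
    case be
    then show ?thesis unfolding p s
      by (auto simp: Let_def min_def split: if_splits)
  next
    case eb
    then show ?thesis using e unfolding p s
      by (auto simp: Let_def min_def split: if_splits)
  qed
qed

section \<open>Relations between reflections of words\<close>

lemma reflect_three_rows:
  assumes "tableau_params f d e a b" "\<forall>z \<in> set rest. foreign m z"
  shows "lower_params (f, d, e, a, b, c) = (f', d', e', a', b', c') \<Longrightarrow>
      reflect_word m (three_rows m f d e a b c @ rest) = three_rows m f' d' e' a' b' c' @ rest"
    and "upper_params (f, d, e, a, b, c) = (f', d', e', a', b', c') \<Longrightarrow>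
      reflect_word (Suc m) (three_rows m f d e a b c @ rest) = three_rows m f' d' e' a' b' c' @ rest"
  using reflect_lower[OF assms] reflect_upper[OF assms] by (auto simp: Let_def)

text \<open>
  On normal forms the reflection exchanges \<open>b\<close> and \<open>a - d\<close>.
\<close>

lemma reflect_word_involution: "reflect_word i (reflect_word i w) = w"
proof -
  obtain f d e a b c rest where t: "tableau_params f d e a b" and r: "\<forall>z \<in> set rest. foreign i z"
    and w: "plactic i w (three_rows i f d e a b c @ rest)" (is "plactic i w ?w'") by (rule normal_form)
  have "tableau_params f d e (b + d) (a - d)" "d \<le> a" using t by (auto simp: tableau_params_def)
  then have "reflect_word i (reflect_word i ?w') = ?w'"
    using reflect_lower[OF t r] reflect_lower[of f d e "b + d" "a - d" rest i c] r by simp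
  then show ?thesis using w unfolding plactic_def by (metis injD)
qed

lemma reflect_word_braid:
  "reflect_word m (reflect_word (Suc m) (reflect_word m w)) =
   reflect_word (Suc m) (reflect_word m (reflect_word (Suc m) w))"
proof -
  obtain f d e a b c rest where t: "tableau_params f d e a b" and r: "\<forall>z \<in> set rest. foreign m z"
    and w: "plactic m w (three_rows m f d e a b c @ rest)" (is "plactic m w ?w'") by (rule normal_form)
  obtain f1 d1 e1 a1 b1 c1 where 1: "lower_params (f, d, e, a, b, c) = (f1, d1, e1, a1, b1, c1)" by (metis prod_cases6)
  obtain f2 d2 e2 a2 b2 c2 where 2: "upper_params (f1, d1, e1, a1, b1, c1) = (f2, d2, e2, a2, b2, c2)" by (metis prod_cases6)
  obtain f3 d3 e3 a3 b3 c3 where 3: "lower_params (f2, d2, e2, a2, b2, c2) = (f3, d3, e3, a3, b3, c3)" by (metis prod_cases6)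
  obtain f4 d4 e4 a4 b4 c4 where 4: "upper_params (f, d, e, a, b, c) = (f4, d4, e4, a4, b4, c4)" by (metis prod_cases6)
  obtain f5 d5 e5 a5 b5 c5 where 5: "lower_params (f4, d4, e4, a4, b4, c4) = (f5, d5, e5, a5, b5, c5)" by (metis prod_cases6)
  obtain f6 d6 e6 a6 b6 c6 where 6: "upper_params (f5, d5, e5, a5, b5, c5) = (f6, d6, e6, a6, b6, c6)" by (metis prod_cases6)
  note t1 = valid_lower[OF t 1] note t2 = valid_upper[OF t1 2]
  note t4 = valid_upper[OF t 4] note t5 = valid_lower[OF t4 5]
  have "reflect_word m (reflect_word (Suc m) (reflect_word m ?w')) = three_rows m f3 d3 e3 a3 b3 c3 @ rest"
    by (simp only: reflect_three_rows(1)[OF t r 1] reflect_three_rows(2)[OF t1 r 2] reflect_three_rows(1)[OF t2 r 3])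
  moreover have "reflect_word (Suc m) (reflect_word m (reflect_word (Suc m) ?w')) = three_rows m f6 d6 e6 a6 b6 c6 @ rest"
    by (simp only: reflect_three_rows(2)[OF t r 4] reflect_three_rows(1)[OF t4 r 5] reflect_three_rows(2)[OF t5 r 6])
  moreover have "(f3, d3, e3, a3, b3, c3) = (f6, d6, e6, a6, b6, c6)"
    using braid_params[OF t, of c] by (simp only: 1 2 3 4 5 6)
  ultimately have "reflect_word m (reflect_word (Suc m) (reflect_word m ?w')) =
    reflect_word (Suc m) (reflect_word m (reflect_word (Suc m) ?w'))" by simp
  moreover obtain h where "inj h" "h w = ?w'"
    and "\<And>v. reflect_word m (h v) = h (reflect_word m v)" "\<And>v. reflect_word (Suc m) (h v) = h (reflect_word (Suc m) v)"
    using w unfolding plactic_def by blast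
  ultimately show ?thesis by (metis injD)
qed

lemma mset_reflect_word: "mset (reflect_word i w) = image_mset (transpose i (Suc i)) (mset w)"
proof -
  obtain f d e a b c rest where t: "tableau_params f d e a b" and r: "\<forall>z \<in> set rest. foreign i z"
    and w: "plactic i w (three_rows i f d e a b c @ rest)" (is "plactic i w ?w'") by (rule normal_form)
  obtain h where h: "h w = ?w'" "\<And>v. mset (h v) = mset v" "\<And>v. reflect_word i (h v) = h (reflect_word i v)"
    using w unfolding plactic_def by blast
  obtain s where s: "a = s + d" using t by (metis tableau_params_def le_add_diff_inverse2)
  have rest: "image_mset (transpose i (Suc i)) (mset rest) = mset rest"
    using r by (intro multiset.map_ident_strong) (auto simp: foreign_def transpose_def)
  have "mset (reflect_word i w) = mset (reflect_word i ?w')" using h by metis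
  also have "\<dots> = image_mset (transpose i (Suc i)) (mset ?w')"
    unfolding reflect_lower[OF t r]
    by (simp add: three_rows_def s rest image_replicate_mset multiset_eq_iff transpose_def)
  also have "mset ?w' = mset w" using h by metis
  finally show ?thesis .
qed

text \<open>
  Reflections whose indices differ by more than one neither read nor change each other's letters.
\<close>

lemma reflect_word_commute:
  assumes "i \<noteq> j" "i \<noteq> Suc j" "j \<noteq> Suc i"
  shows "reflect_word i (reflect_word j w) = reflect_word j (reflect_word i w)"
proof -
  have opens: "opens k b (reflect_from l B r a b' w) = opens k b w"
    and demand: "demand k s (reflect_from l B r a b' w) = demand k s w"
    if "k \<noteq> l" "k \<noteq> Suc l" "l \<noteq> Suc k" for k l b s B r a b' w
    using that by (induction w arbitrary: b a b') auto
  have "reflect_from i B 0 a b (reflect_from j B' 0 a' b' w) = reflect_from j B' 0 a' b' (reflect_from i B 0 a b w)" for B B' a b a' b'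
    using assms by (induction w arbitrary: a b a' b') (auto simp: demand)
  then show ?thesis using assms by (simp add: reflect_word_def opens)
qed

section \<open>Coxeter elements\<close>

text \<open>
  The order of a Coxeter element follows from these relations alone. They hold for the reflections of
  words as well as for adjacent transpositions, whose Coxeter element is the \<open>n\<close>-cycle.
\<close>

locale symmetric_group_relations =
  fixes s :: "nat \<Rightarrow> 'a \<Rightarrow> 'a"
  assumes involution: "s i (s i x) = x"
    and braid: "s i (s (Suc i) (s i x)) = s (Suc i) (s i (s (Suc i) x))"
    and commute: "i \<noteq> j \<Longrightarrow> i \<noteq> Suc j \<Longrightarrow> j \<noteq> Suc i \<Longrightarrow> s i (s j x) = s j (s i x)"
begin

text \<open>
  The first reflection is applied first, so this is the product \<open>s (k-1) \<dots> s 2 s 1\<close>.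
\<close>

definition coxeter :: "nat \<Rightarrow> 'a \<Rightarrow> 'a" where
  "coxeter k = fold s [1..<k]"

lemma coxeter_Suc: "1 \<le> k \<Longrightarrow> coxeter (Suc k) x = s k (coxeter k x)"
  by (simp add: coxeter_def)

lemma coxeter_trivial: "coxeter 0 x = x" "coxeter (Suc 0) x = x"
  by (simp_all add: coxeter_def)

lemma commute_coxeter: "k < j \<Longrightarrow> s j (coxeter k x) = coxeter k (s j x)"
proof (induction k arbitrary: x)
  case (Suc k)
  then show ?case
    by (cases "k = 0") (simp_all add: coxeter_trivial coxeter_Suc commute[of j k])
qed (simp add: coxeter_trivial)

text \<open>
  Conjugation by the cycle lowers the index of a reflection. The reflection commutes past the factors
  of small index, passes the two neighbouring factors by the braid relation, and leaves with index
  \<open>i - 1\<close>, which commutes with the remaining factors.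
\<close>

lemma coxeter_shift: "2 \<le> i \<Longrightarrow> i < k \<Longrightarrow> coxeter k (s i x) = s (i - 1) (coxeter k x)"
proof (induction k arbitrary: x)
  case (Suc k)
  show ?case
  proof (cases "i = k")
    case True
    obtain j where k: "k = Suc j" "1 \<le> j" using Suc.prems True by (cases k) auto
    have "coxeter (Suc k) (s k x) = s (Suc j) (s j (s (Suc j) (coxeter j x)))"
      using k by (simp add: coxeter_Suc commute_coxeter)
    also have "\<dots> = s j (coxeter (Suc k) x)"
      using k by (simp add: coxeter_Suc braid)
    finally show ?thesis using True k by simp
  next
    case False
    then have i: "i < k" "1 \<le> k" using Suc.prems by simp_all
    have "coxeter (Suc k) (s i x) = s k (s (i - 1) (coxeter k x))"
      using Suc.IH[of x] Suc.prems i by (simp add: coxeter_Suc)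
    also have "\<dots> = s (i - 1) (s k (coxeter k x))"
      by (rule commute) (use i Suc.prems in auto)
    finally show ?thesis using i by (simp add: coxeter_Suc)
  qed
qed simp

primrec ascending :: "nat \<Rightarrow> nat \<Rightarrow> 'a \<Rightarrow> 'a" where
  "ascending l 0 x = x"
| "ascending l (Suc j) x = ascending l j (s (l + j) x)"

lemma coxeter_ascending:
  "1 \<le> l \<Longrightarrow> l + j < k \<Longrightarrow> coxeter k (ascending (Suc l) j x) = ascending l j (coxeter k x)"
proof (induction j arbitrary: x)
  case (Suc j)
  then show ?case using coxeter_shift[of "Suc (l + j)" k x] by simp
qed simp

lemma coxeter_ascending_inverse: "coxeter (Suc k) (ascending 1 k x) = x"
proof (induction k arbitrary: x)
  case (Suc k)
  then show ?case by (simp add: coxeter_Suc involution)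
qed (simp add: coxeter_trivial)

text \<open>
  When another factor \<open>coxeter (Suc k)\<close>, that is \<open>s k\<close> after \<open>coxeter k\<close>, is multiplied on the left, the
  reflections accumulated so far pass to its left, and each index drops by one. This makes room
  for the new \<open>s k\<close> at the end.
\<close>

lemma coxeter_power:
  "1 \<le> k \<Longrightarrow> j \<le> k \<Longrightarrow> (coxeter (Suc k) ^^ j) x = ascending (Suc k - j) j ((coxeter k ^^ j) x)"
proof (induction j)
  case (Suc j)
  have "(coxeter (Suc k) ^^ Suc j) x = coxeter (Suc k) (ascending (Suc (k - j)) j ((coxeter k ^^ j) x))"
    using Suc by (simp add: Suc_diff_le)
  also have "\<dots> = ascending (k - j) j (coxeter (Suc k) ((coxeter k ^^ j) x))"
    using Suc.prems by (intro coxeter_ascending) auto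
  also have "\<dots> = ascending (k - j) (Suc j) ((coxeter k ^^ Suc j) x)"
    using Suc.prems by (simp add: coxeter_Suc)
  finally show ?case by simp
qed simp

text \<open>
  By induction the previous lemma gives \<open>coxeter (Suc k) ^^ k = s 1 \<dots> s k\<close>, the inverse of
  \<open>coxeter (Suc k)\<close>.
\<close>

lemma coxeter_order: "(coxeter n ^^ n) x = x"
proof (induction n arbitrary: x)
  case (Suc k)
  show ?case
  proof (cases "k = 0")
    case False
    then have "(coxeter (Suc k) ^^ k) x = ascending 1 k x"
      using coxeter_power[of k k x] Suc by simp
    then show ?thesis using coxeter_ascending_inverse[of k x] by simp
  qed (simp add: coxeter_trivial)
qed simp

end

interpretation words: symmetric_group_relations reflect_word
  by unfold_locales
    (auto simp: reflect_word_involution reflect_word_braid intro: reflect_word_commute)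

interpretation transpositions: symmetric_group_relations "\<lambda>i. transpose i (Suc i)"
  by unfold_locales (auto simp: transpose_def)

section \<open>From boxes to words\<close>

text \<open>
  The unmatched boxes with letter \<open>i\<close> and those with letter \<open>Suc i\<close>, described without the
  list that the scan of the reading word maintains.
\<close>

fun unmatched_lower :: "nat \<Rightarrow> ('b \<Rightarrow> nat) \<Rightarrow> nat \<Rightarrow> 'b list \<Rightarrow> 'b list" where
  "unmatched_lower i T b [] = []"
| "unmatched_lower i T b (x # v) =
     (if T x = Suc i then unmatched_lower i T (Suc b) v
      else if T x = i then (if b = 0 then x # unmatched_lower i T 0 v else unmatched_lower i T (b - 1) v)
      else unmatched_lower i T b v)"

fun unmatched_upper :: "nat \<Rightarrow> ('b \<Rightarrow> nat) \<Rightarrow> 'b list \<Rightarrow> 'b list" where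
  "unmatched_upper i T [] = []"
| "unmatched_upper i T (x # v) =
     (if T x = Suc i \<and> demand i 0 (map T v) = 0 then x # unmatched_upper i T v else unmatched_upper i T v)"

lemma unmatched_lower_props:
  "length (unmatched_lower i T b v) = demand i 0 (map T v) - b"
  "set (unmatched_lower i T b v) \<subseteq> {x \<in> set v. T x = i}"
  by (induction v arbitrary: b) auto

lemma unmatched_upper_props: "set (unmatched_upper i T v) \<subseteq> {x \<in> set v. T x = Suc i}"
  by (induction v) auto

lemma length_unmatched_upper:
  "opens i b (map T v) = (b - demand i 0 (map T v)) + length (unmatched_upper i T v)"
  by (induction v arbitrary: b) auto

text \<open>
  The scan keeps the unmatched closing boxes \<open>As\<close> in front of the pending opening boxes \<open>Bs\<close>.
  Later closing boxes consume \<open>Bs\<close> from its end, which is why a prefix of it survives.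
\<close>

lemma fold_match_step:
  assumes "\<forall>x \<in> set As. T x = i" "\<forall>x \<in> set Bs. T x = Suc i"
  shows "fold (match_step i T) v (As @ Bs) =
    As @ unmatched_lower i T (length Bs) v @ take (length Bs - demand i 0 (map T v)) Bs @ unmatched_upper i T v"
  using assms
proof (induction v arbitrary: As Bs)
  case (Cons x v)
  show ?case
  proof (cases "T x = Suc i")
    case True
    then have "match_step i T x (As @ Bs) = As @ (Bs @ [x])" by (simp add: match_step_def)
    then show ?thesis using Cons.IH[of As "Bs @ [x]"] Cons.prems True by simp
  next
    case up: False
    show ?thesis
    proof (cases "T x = i")
      case True
      show ?thesis
      proof (cases Bs rule: rev_cases)
        case Nil
        then have "match_step i T x (As @ Bs) = (As @ [x]) @ []"
          using True Cons.prems(1,2) by (auto simp: match_step_def dest: last_in_set)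
        then show ?thesis using Cons.IH[of "As @ [x]" "[]"] Cons.prems True Nil by simp
      next
        case (snoc Bs' y)
        then have "match_step i T x (As @ Bs) = As @ Bs'"
          using True Cons.prems snoc by (auto simp: match_step_def butlast_append)
        then show ?thesis using Cons.IH[of As Bs'] Cons.prems True snoc by simp
      qed
    next
      case False
      then have "match_step i T x (As @ Bs) = As @ Bs" using up by (simp add: match_step_def)
      then show ?thesis using Cons.IH[of As Bs] Cons.prems up False by simp
    qed
  qed
qed simp

text \<open>
  The list \<open>F\<close> of all unmatched boxes stays the same while the scan advances from \<open>x # v\<close>
  to \<open>v\<close>, so the relabelling \<open>T'\<close> is fixed during the induction and the position of \<open>x\<close> in \<open>F\<close> can
  be read off from the lists \<open>As\<close> and \<open>Bs\<close> at the moment when \<open>x\<close> is scanned.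
\<close>

lemma relabel_eq_reflect_from:
  fixes i B :: nat and T :: "'b \<Rightarrow> nat" and F :: "'b list"
  defines "T' \<equiv> \<lambda>c. if c \<in> set (take B F) then i else if c \<in> set (drop B F) then Suc i else T c"
  assumes "\<forall>x \<in> set As. T x = i" "\<forall>x \<in> set Bs. T x = Suc i" "distinct (As @ Bs @ v)"
    and "F = fold (match_step i T) v (As @ Bs)"
  shows "map T' v = reflect_from i B 0 (length As) (length Bs) (map T v)"
  using assms(2-)
proof (induction v arbitrary: As Bs)
  case (Cons x v)
  have F: "F = As @ unmatched_lower i T (length Bs) (x # v) @
     take (length Bs - demand i 0 (map T (x # v))) Bs @ unmatched_upper i T (x # v)"
    using Cons.prems fold_match_step by metis
  have outside: "T' y = T y" if "y \<notin> set F" for y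
    using that unfolding T'_def by (meson in_set_takeD in_set_dropD)
  have position: "T' y = (if length p < B then i else Suc i)" if "F = p @ y # q" "y \<notin> set p" "y \<notin> set q" for y p q
  proof (cases "length p < B")
    case True
    then have "y \<in> set (take B F)" using that(1) by (cases "B - length p") auto
    then show ?thesis using True by (simp add: T'_def)
  next
    case False
    then have "set (take B F) \<subseteq> set p" "y \<in> set (drop B F)" using that(1) by (auto dest: in_set_takeD)
    then show ?thesis using False that by (auto simp: T'_def)
  qed
  have x: "x \<notin> set v" "x \<notin> set As" "x \<notin> set Bs" using Cons.prems by auto
  have low: "length (unmatched_lower i T b v) = demand i 0 (map T v) - b"
    "x \<notin> set (unmatched_lower i T b v)" for b
    using unmatched_lower_props[of i T b v] x by auto
  have upp: "x \<notin> set (unmatched_upper i T v)" using unmatched_upper_props[of i T v] x by auto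
  show ?case
  proof (cases "T x = Suc i")
    case True
    then have m: "match_step i T x (As @ Bs) = As @ (Bs @ [x])" by (simp add: match_step_def)
    have IH: "map T' v = reflect_from i B 0 (length As) (Suc (length Bs)) (map T v)"
      using Cons.IH[of As "Bs @ [x]"] Cons.prems True m by simp
    have "T' x = (if demand i 0 (map T v) = 0 \<and> length As + length Bs < B then i else Suc i)"
    proof (cases "demand i 0 (map T v) = 0")
      case d: True
      then have "unmatched_lower i T (Suc (length Bs)) v = []"
        using low(1)[of "Suc (length Bs)"] by simp
      then have "F = (As @ Bs) @ x # unmatched_upper i T v"
        using F True d by simp
      then show ?thesis using position[of "As @ Bs" x] x upp d by auto
    next
      case d: False
      then have "x \<notin> set F" using F True x low(2) upp by (auto dest: in_set_takeD)
      then show ?thesis using outside True d by simp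
    qed
    then show ?thesis using True IH by simp
  next
    case up: False
    show ?thesis
    proof (cases "T x = i")
      case True
      show ?thesis
      proof (cases Bs rule: rev_cases)
        case Nil
        then have m: "match_step i T x (As @ Bs) = (As @ [x]) @ []"
          using True Cons.prems(1,2) by (auto simp: match_step_def dest: last_in_set)
        have IH: "map T' v = reflect_from i B 0 (Suc (length As)) 0 (map T v)"
          using Cons.IH[of "As @ [x]" "[]"] Cons.prems True m Nil by simp
        have "F = As @ x # (unmatched_lower i T 0 v @ unmatched_upper i T v)"
          using F True Nil by simp
        then have "T' x = (if length As < B then i else Suc i)"
          using position[of As x] x low(2) upp by auto
        then show ?thesis using True IH Nil by simp
      next
        case (snoc Bs' y)
        then have m: "match_step i T x (As @ Bs) = As @ Bs'"
          using True Cons.prems(2) snoc by (simp add: match_step_def butlast_append)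
        have IH: "map T' v = reflect_from i B 0 (length As) (length Bs') (map T v)"
          using Cons.IH[of As Bs'] Cons.prems True m snoc by simp
        have "x \<notin> set F" using F True x low(2) upp snoc by (auto dest: in_set_takeD)
        then show ?thesis using outside True IH snoc by simp
      qed
    next
      case False
      then have m: "match_step i T x (As @ Bs) = As @ Bs" using up by (simp add: match_step_def)
      have IH: "map T' v = reflect_from i B 0 (length As) (length Bs) (map T v)"
        using Cons.IH[of As Bs] Cons.prems m by simp
      have "x \<notin> set F" using F False up x low(2) upp by (auto dest: in_set_takeD)
      then show ?thesis using outside up False IH by simp
    qed
  qed
qed simp

lemma unmatched_eq: "unmatched i T bs = unmatched_lower i T 0 bs @ unmatched_upper i T bs"
  using fold_match_step[of "[]" T i "[]" bs] by (simp add: unmatched_def)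

section \<open>Reading words of tableaux\<close>

lemma support_partition:
  assumes "is_partition lam"
  shows "{i. lam i \<noteq> 0} = {..<partition_length lam}"
proof -
  have fin: "finite {i. lam i \<noteq> 0}" and anti: "\<And>i j. i \<le> j \<Longrightarrow> lam j \<le> lam i"
    using assms by (auto simp: is_partition_def antimono_def)
  obtain L where L: "lam L = 0" using ex_new_if_finite[OF infinite_UNIV_nat fin] by blast
  define K where "K = (LEAST k. lam k = 0)"
  have "lam K = 0" unfolding K_def using L by (rule LeastI)
  then have "i < K" if "lam i \<noteq> 0" for i
    using that anti[of K i] by (metis le_zero_eq linorder_not_less)
  moreover have "lam i \<noteq> 0" if "i < K" for i
    using that not_less_Least[of i "\<lambda>k. lam k = 0"] unfolding K_def by simp
  ultimately have "{i. lam i \<noteq> 0} = {..<K}" by auto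
  then show ?thesis by (simp add: partition_length_def)
qed

definition row_boxes :: "(nat \<Rightarrow> nat) \<Rightarrow> (nat \<Rightarrow> nat) \<Rightarrow> nat \<Rightarrow> (nat \<times> nat) list" where
  "row_boxes lam mu r = map (Pair r) [mu r..<lam r]"

lemma reading_boxes_rows:
  "reading_boxes lam mu = concat (map (row_boxes lam mu) (rev [0..<partition_length lam]))"
  by (simp add: reading_boxes_def row_boxes_def [abs_def])

lemma set_reading_boxes:
  assumes "is_partition lam"
  shows "set (reading_boxes lam mu) = diagram lam mu"
proof -
  have "r < partition_length lam \<longleftrightarrow> lam r \<noteq> 0" for r
    using support_partition[OF assms] by blast
  then have "set (reading_boxes lam mu) = (\<Union>r \<in> {r. lam r \<noteq> 0}. Pair r ` {mu r..<lam r})"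
    by (simp add: reading_boxes_def atLeast0LessThan lessThan_def)
  also have "\<dots> = diagram lam mu"
  proof (intro equalityI subsetI)
    fix x assume "x \<in> diagram lam mu"
    then obtain r c where x: "x = (r, c)" "mu r \<le> c" "c < lam r" by (auto simp: diagram_def)
    then show "x \<in> (\<Union>r \<in> {r. lam r \<noteq> 0}. Pair r ` {mu r..<lam r})"
      by (intro UN_I[of r]) auto
  qed (auto simp: diagram_def)
  finally show ?thesis .
qed

lemma distinct_reading_boxes: "distinct (reading_boxes lam mu)"
proof -
  have "distinct (concat (map (row_boxes lam mu) rs))" if "distinct rs" for rs
    using that by (induction rs) (auto simp: row_boxes_def distinct_map inj_on_def)
  then show ?thesis by (simp add: reading_boxes_rows)
qed

lemma crystal_reflection_word:
  "map (crystal_reflection lam mu i T) (reading_boxes lam mu) = reflect_word i (map T (reading_boxes lam mu))"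
proof -
  let ?bs = "reading_boxes lam mu"
  have "filter (\<lambda>c. T c = Suc i) (unmatched_lower i T 0 ?bs) = []"
    using unmatched_lower_props(2)[of i T 0 ?bs] by (auto simp: filter_empty_conv)
  moreover have "filter (\<lambda>c. T c = Suc i) (unmatched_upper i T ?bs) = unmatched_upper i T ?bs"
    using unmatched_upper_props[of i T ?bs] by (auto simp: filter_id_conv)
  ultimately have "length (filter (\<lambda>c. T c = Suc i) (unmatched i T ?bs)) = opens i 0 (map T ?bs)"
    by (simp add: unmatched_eq length_unmatched_upper)
  moreover have "unmatched i T ?bs = fold (match_step i T) ?bs ([] @ [])"
    by (simp add: unmatched_def)
  then have "map (\<lambda>c. if c \<in> set (take B (unmatched i T ?bs)) then i
      else if c \<in> set (drop B (unmatched i T ?bs)) then Suc i else T c) ?bs = reflect_from i B 0 0 0 (map T ?bs)" for B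
    using relabel_eq_reflect_from[of "[]" T i "[]" ?bs "unmatched i T ?bs" B] distinct_reading_boxes by simp
  ultimately show ?thesis
    by (simp only: crystal_reflection_def Let_def reflect_word_def)
qed

lemma crystal_reflection_cases:
  "crystal_reflection lam mu i T c \<in> {T c, i, Suc i}"
  "c \<notin> set (reading_boxes lam mu) \<Longrightarrow> crystal_reflection lam mu i T c = T c"
proof -
  show "crystal_reflection lam mu i T c \<in> {T c, i, Suc i}"
    by (auto simp: crystal_reflection_def Let_def)
  have "set (unmatched i T (reading_boxes lam mu)) \<subseteq> set (reading_boxes lam mu)"
    using unmatched_lower_props(2)[of i T 0 "reading_boxes lam mu"]
      unmatched_upper_props[of i T "reading_boxes lam mu"] by (auto simp: unmatched_eq)
  then show "c \<notin> set (reading_boxes lam mu) \<Longrightarrow> crystal_reflection lam mu i T c = T c"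
    by (auto simp: crystal_reflection_def Let_def dest: in_set_takeD in_set_dropD)
qed

section \<open>Reflections preserve semistandardness\<close>

text \<open>
  Rows stay weakly increasing: in a sorted word, if a letter is raised then so are the later letters
  equal to it, and if a letter is lowered then so are the earlier ones; both cannot happen.
\<close>

lemma sorted_reflect_from: "sorted w \<Longrightarrow> sorted (reflect_from i B r a b w)"
proof (induction w arbitrary: a b rule: induct_list012)
  case (3 x y w)
  have xy: "x \<le> y" using 3 by simp
  obtain a' b' where r: "reflect_from i B r a b (x # y # w) =
      hd (reflect_from i B r a b (x # y # w)) # reflect_from i B r a' b' (y # w)"
    and le: "hd (reflect_from i B r a b (x # y # w)) \<le> hd (reflect_from i B r a' b' (y # w))"
  proof -
    consider "x = Suc i" | "x = i" | "x \<noteq> i" "x \<noteq> Suc i" by blast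
    then show thesis
    proof cases
      case 1
      then show thesis using xy by (intro that[of a "Suc b"]) auto
    next
      case 2
      then show thesis using xy by (cases "b = 0"; intro that[of "if b = 0 then Suc a else a" "b - 1"]) auto
    next
      case 3
      then show thesis using xy by (intro that[of a b]) auto
    qed
  qed
  moreover have "reflect_from i B r a' b' (y # w) \<noteq> []" by simp
  moreover have "sorted (reflect_from i B r a' b' (y # w))" using 3 by (metis sorted_wrt.simps(2))
  ultimately show ?case
    by (metis list.collapse sorted2)
qed auto

lemma opens_ge: "i \<notin> set w \<Longrightarrow> b \<le> opens i b w"
proof (induction w arbitrary: b)
  case (Cons x w)
  then show ?case using Cons.IH[of b] Suc_leD[OF Cons.IH[of "Suc b"]] by auto
qed simp

lemma demand_ge: "Suc i \<notin> set w \<Longrightarrow> r \<le> demand i r w"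
  by (induction w) auto

lemma crystal_reflection_segment:
  assumes "reading_boxes lam mu = A @ R @ C"
  shows "map (crystal_reflection lam mu i T) R =
    reflect_from i (opens i 0 (map T (reading_boxes lam mu))) (demand i 0 (map T C))
      (closes i 0 0 (map T A)) (opens i 0 (map T A)) (map T R)"
proof -
  let ?B = "opens i 0 (map T (reading_boxes lam mu))"
  have "map (crystal_reflection lam mu i T) A @ map (crystal_reflection lam mu i T) R @ map (crystal_reflection lam mu i T) C =
    reflect_from i ?B 0 0 0 (map T A @ map T R @ map T C)"
    using crystal_reflection_word[of lam mu i T] by (simp add: reflect_word_def assms)
  then show ?thesis
    unfolding reflect_from_append demand_append by (simp del: map_append)
qed

lemma reading_boxes_row:
  assumes "r < partition_length lam"
  obtains A C where "reading_boxes lam mu = A @ row_boxes lam mu r @ C"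
proof -
  have "r \<in> set (rev [0..<partition_length lam])" using assms by simp
  then obtain xs ys where "rev [0..<partition_length lam] = xs @ r # ys" by (meson split_list)
  then show thesis by (intro that) (simp add: reading_boxes_rows)
qed

lemma upt_split: "i \<le> j \<Longrightarrow> j \<le> k \<Longrightarrow> [i..<k] = [i..<j] @ [j..<k]"
  using upt_add_eq_append[of i j "k - j"] by simp

lemma reading_boxes_two_rows:
  assumes "Suc r < partition_length lam"
  obtains A C where "reading_boxes lam mu = A @ row_boxes lam mu (Suc r) @ row_boxes lam mu r @ C"
proof -
  have "[0..<partition_length lam] = [0..<r] @ [r..<partition_length lam]"
    using assms by (intro upt_split) auto
  also have "[r..<partition_length lam] = r # Suc r # [Suc (Suc r)..<partition_length lam]"
    using assms by (simp add: upt_conv_Cons)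
  finally have "reading_boxes lam mu = concat (map (row_boxes lam mu) (rev [Suc (Suc r)..<partition_length lam])) @
     row_boxes lam mu (Suc r) @ row_boxes lam mu r @ concat (map (row_boxes lam mu) (rev [0..<r]))"
    by (simp add: reading_boxes_rows)
  then show thesis by (rule that)
qed

lemma row_boxes_split:
  assumes "mu r \<le> j" "j \<le> k" "k \<le> lam r"
  shows "row_boxes lam mu r = map (Pair r) [mu r..<j] @ map (Pair r) [j..<k] @ map (Pair r) [k..<lam r]"
  using assms upt_split[of "mu r" j "lam r"] upt_split[of j k "lam r"] by (simp add: row_boxes_def)

text \<open>
  The only way in which a column could cease to be strict is that one of two vertically adjacent
  letters \<open>i\<close> and \<open>Suc i\<close> changes. Around such a pair the two rows contain a rectangle with letters
  \<open>i\<close> above \<open>Suc i\<close>, bounded by the first \<open>i\<close> in the upper row and by the last \<open>Suc i\<close> in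
  the lower row. No other letters \<open>i\<close> or \<open>Suc i\<close> that could interfere are read in between, so the
  rectangle contains partners for both letters of the pair, and matched letters do not change.
\<close>

lemma vertical_pair_fixed:
  assumes shape: "skew_shape lam mu" and T: "T \<in> SSYT lam mu n"
    and d: "(r, j) \<in> diagram lam mu" "(Suc r, j) \<in> diagram lam mu"
    and i: "T (r, j) = i" "T (Suc r, j) = Suc i"
  shows "crystal_reflection lam mu i T (r, j) = i"
    and "crystal_reflection lam mu i T (Suc r, j) = Suc i"
proof -
  have lamS: "lam (Suc r) \<le> lam r" and muS: "mu (Suc r) \<le> mu r" and part: "is_partition lam"
    using shape by (auto simp: skew_shape_def is_partition_def antimono_def)
  have j: "mu r \<le> j" "j < lam (Suc r)" using d by (auto simp: diagram_def)
  have row: "T (q, c) \<le> T (q, c')" if "mu q \<le> c" "c \<le> c'" "c' < lam q" for q c c'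
    using T that by (cases "c = c'") (auto simp: SSYT_def diagram_def)
  have col: "T (r, c) < T (Suc r, c)" if "mu r \<le> c" "c < lam (Suc r)" for c
    using T that lamS muS by (auto simp: SSYT_def diagram_def)
  have "lam (Suc r) \<noteq> 0" using j by simp
  then have "Suc r < partition_length lam" using support_partition[OF part] by blast
  then obtain A C where bs: "reading_boxes lam mu = A @ row_boxes lam mu (Suc r) @ row_boxes lam mu r @ C"
    by (rule reading_boxes_two_rows)
  let ?w = "\<lambda>q a b. map T (map (Pair q) [a..<b])"

  show "crystal_reflection lam mu i T (r, j) = i"
  proof -
    \<comment> \<open>Columns \<open>p\<close> to \<open>j\<close> of the lower row contain more opening letters than are closed before
      \<open>(r, j)\<close> is read.\<close>
    define p where "p = (LEAST c. mu r \<le> c \<and> T (r, c) = i)"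
    have p: "mu r \<le> p" "T (r, p) = i" "p \<le> j"
      using LeastI[of "\<lambda>c. mu r \<le> c \<and> T (r, c) = i" j] Least_le[of "\<lambda>c. mu r \<le> c \<and> T (r, c) = i" j] j i
      by (auto simp: p_def)
    have before: "T (r, c) < i" if "mu r \<le> c" "c < p" for c
    proof -
      have "T (r, c) \<noteq> i" using not_less_Least[of c "\<lambda>c. mu r \<le> c \<and> T (r, c) = i"] that by (auto simp: p_def)
      moreover have "T (r, c) \<le> i" using row[of r c j] that p j lamS i by simp
      ultimately show ?thesis by simp
    qed
    have run: "T (r, c) = i" "T (Suc r, c) = Suc i" if "p \<le> c" "c \<le> j" for c
    proof -
      show "T (r, c) = i" using row[of r p c] row[of r c j] that p j lamS i by simp
      then show "T (Suc r, c) = Suc i" using row[of "Suc r" c j] col[of c] that p j muS i by simp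
    qed
    have upper_run: "?w (Suc r) p (Suc j) = replicate (Suc j - p) (Suc i)"
      using run(2) by (intro replicate_eqI) auto
    have lower_run: "?w r p j = replicate (j - p) i"
      using run(1) by (intro replicate_eqI) auto
    let ?P = "A @ map (Pair (Suc r)) [mu (Suc r)..<p]"
    have bs': "reading_boxes lam mu = (?P @ map (Pair (Suc r)) [p..<Suc j] @ map (Pair (Suc r)) [Suc j..<lam (Suc r)]
       @ map (Pair r) [mu r..<p] @ map (Pair r) [p..<j]) @ [(r, j)] @ (map (Pair r) [Suc j..<lam r] @ C)"
      using row_boxes_split[of mu "Suc r" p "Suc j" lam] row_boxes_split[of mu r p j lam] p j lamS muS
        upt_conv_Cons[of j "lam r"]
      by (simp add: bs)
    define b where "b = opens i 0 (map T ?P)"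
    have "i \<notin> set (?w (Suc r) (Suc j) (lam (Suc r)) @ ?w r (mu r) p)"
    proof -
      have above: "i \<noteq> T (Suc r, c)" if "Suc j \<le> c" "c < lam (Suc r)" for c
        using row[of "Suc r" j c] that j muS i by simp
      have below: "i \<noteq> T (r, c)" if "mu r \<le> c" "c < p" for c
        using before[of c] that by simp
      show ?thesis by (auto simp: below above)
    qed
    then have "Suc j - p \<le> opens i (b + (Suc j - p)) (?w (Suc r) (Suc j) (lam (Suc r)) @ ?w r (mu r) p)"
      using opens_ge[of i _ "b + (Suc j - p)"] by (meson add_leD2)
    then have "0 < opens i 0 (map T (?P @ map (Pair (Suc r)) [p..<Suc j] @ map (Pair (Suc r)) [Suc j..<lam (Suc r)]
       @ map (Pair r) [mu r..<p] @ map (Pair r) [p..<j]))"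
      unfolding map_append opens_append upper_run lower_run counters_replicate
      using p by (simp add: b_def opens_append)
    then show ?thesis
      using crystal_reflection_segment[OF bs', of i T] i(1) by simp
  qed

  show "crystal_reflection lam mu i T (Suc r, j) = Suc i"
  proof -
    \<comment> \<open>Columns \<open>j\<close> to \<open>q\<close> of the upper row contain more closing letters than are opened after
      \<open>(Suc r, j)\<close> is read.\<close>
    define q where "q = (GREATEST c. c < lam (Suc r) \<and> T (Suc r, c) = Suc i)"
    have "q < lam (Suc r) \<and> T (Suc r, q) = Suc i"
      unfolding q_def by (rule GreatestI_nat[of _ j "lam (Suc r)"]) (use j i in auto)
    moreover have greatest: "c \<le> q" if "c < lam (Suc r) \<and> T (Suc r, c) = Suc i" for c
      unfolding q_def by (rule Greatest_le_nat[of _ c "lam (Suc r)"]) (use that in auto)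
    ultimately have q: "j \<le> q" "q < lam (Suc r)" "T (Suc r, q) = Suc i"
      using j i by auto
    have after: "Suc i < T (Suc r, c)" if "q < c" "c < lam (Suc r)" for c
    proof -
      have "T (Suc r, c) \<noteq> Suc i" using greatest[of c] that by auto
      moreover have "Suc i \<le> T (Suc r, c)" using row[of "Suc r" j c] that q j muS i by simp
      ultimately show ?thesis by simp
    qed
    have run: "T (r, c) = i" "T (Suc r, c) = Suc i" if "j \<le> c" "c \<le> q" for c
    proof -
      show "T (Suc r, c) = Suc i" using row[of "Suc r" j c] row[of "Suc r" c q] that q j muS i by simp
      then show "T (r, c) = i" using row[of r j c] col[of c] that q j lamS i by simp
    qed
    have upper_run: "?w (Suc r) (Suc j) (Suc q) = replicate (q - j) (Suc i)"
      using run(2) by (intro replicate_eqI) auto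
    have lower_run: "?w r j (Suc q) = replicate (Suc q - j) i"
      using run(1) by (intro replicate_eqI) auto
    let ?Q = "map (Pair r) [Suc q..<lam r] @ C"
    have bs': "reading_boxes lam mu = (A @ map (Pair (Suc r)) [mu (Suc r)..<j]) @ [(Suc r, j)] @
       (map (Pair (Suc r)) [Suc j..<Suc q] @ map (Pair (Suc r)) [Suc q..<lam (Suc r)]
       @ map (Pair r) [mu r..<j] @ map (Pair r) [j..<Suc q] @ ?Q)"
    proof -
      have "row_boxes lam mu (Suc r) = map (Pair (Suc r)) [mu (Suc r)..<j] @
          map (Pair (Suc r)) [j..<Suc q] @ map (Pair (Suc r)) [Suc q..<lam (Suc r)]"
        by (rule row_boxes_split) (use q j muS in auto)
      moreover have "map (Pair (Suc r)) [j..<Suc q] = (Suc r, j) # map (Pair (Suc r)) [Suc j..<Suc q]"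
        using q by (simp add: upt_conv_Cons del: upt_Suc)
      moreover have "row_boxes lam mu r = map (Pair r) [mu r..<j] @
          map (Pair r) [j..<Suc q] @ map (Pair r) [Suc q..<lam r]"
        by (rule row_boxes_split) (use q j lamS in auto)
      ultimately show ?thesis
        by (simp only: bs append_assoc append_Cons append_Nil)
    qed
    define d where "d = demand i 0 (map T ?Q)"
    have "Suc i \<notin> set (?w (Suc r) (Suc q) (lam (Suc r)) @ ?w r (mu r) j)"
    proof -
      have below: "Suc i \<noteq> T (r, c)" if "mu r \<le> c" "c < j" for c
        using row[of r c j] that j lamS i by simp
      have above: "Suc i \<noteq> T (Suc r, c)" if "Suc q \<le> c" "c < lam (Suc r)" for c
        using after[of c] that by simp
      show ?thesis by (auto simp: below above)
    qed
    then have "Suc q - j \<le> demand i (d + (Suc q - j)) (?w (Suc r) (Suc q) (lam (Suc r)) @ ?w r (mu r) j)"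
      using demand_ge[of i _ "d + (Suc q - j)"] by (meson add_leD2)
    then have *: "0 < demand i (d + (Suc q - j)) (?w (Suc r) (Suc q) (lam (Suc r)) @ ?w r (mu r) j) - (q - j)"
      using q by linarith
    define V where "V = map (Pair (Suc r)) [Suc j..<Suc q] @ map (Pair (Suc r)) [Suc q..<lam (Suc r)]
       @ map (Pair r) [mu r..<j] @ map (Pair r) [j..<Suc q] @ ?Q"
    have "demand i 0 (map T V) = demand i (d + (Suc q - j)) (?w (Suc r) (Suc q) (lam (Suc r)) @ ?w r (mu r) j) - (q - j)"
      unfolding V_def d_def map_append demand_append upper_run lower_run counters_replicate ..
    then have "demand i 0 (map T V) \<noteq> 0" using * by linarith
    then show ?thesis
      using crystal_reflection_segment[OF bs'[folded V_def], of i T] i(2) by simp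
  qed
qed

text \<open>
  A box is unmatched only if it carries one of the two letters concerned.
\<close>

lemma crystal_reflection_changed:
  "crystal_reflection lam mu i T c \<noteq> T c \<Longrightarrow> T c \<in> {i, Suc i} \<and> crystal_reflection lam mu i T c \<in> {i, Suc i}"
proof -
  have "set (unmatched i T (reading_boxes lam mu)) \<subseteq> {c. T c \<in> {i, Suc i}}"
    using unmatched_lower_props(2)[of i T 0 "reading_boxes lam mu"]
      unmatched_upper_props[of i T "reading_boxes lam mu"] by (auto simp: unmatched_eq)
  then show "crystal_reflection lam mu i T c \<noteq> T c \<Longrightarrow> T c \<in> {i, Suc i} \<and> crystal_reflection lam mu i T c \<in> {i, Suc i}"
    by (auto simp: crystal_reflection_def Let_def dest!: in_set_takeD in_set_dropD split: if_splits)
qed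

lemma crystal_reflection_SSYT:
  assumes shape: "skew_shape lam mu" and T: "T \<in> SSYT lam mu n" and i: "1 \<le> i" "i < n"
  shows "crystal_reflection lam mu i T \<in> SSYT lam mu n"
proof -
  let ?T = "crystal_reflection lam mu i T"
  have part: "is_partition lam" and lam: "\<And>p q. p \<le> q \<Longrightarrow> lam q \<le> lam p" and mu: "\<And>p q. p \<le> q \<Longrightarrow> mu q \<le> mu p"
    using shape by (auto simp: skew_shape_def is_partition_def antimono_def)
  have ext: "?T \<in> diagram lam mu \<rightarrow>\<^sub>E {1..n}"
  proof (rule PiE_I)
    fix c assume "c \<in> diagram lam mu"
    then have "T c \<in> {1..n}" using T by (auto simp: SSYT_def)
    then show "?T c \<in> {1..n}" using crystal_reflection_cases(1)[of lam mu i T c] i by auto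
  next
    fix c assume c: "c \<notin> diagram lam mu"
    then have "?T c = T c" using crystal_reflection_cases(2) set_reading_boxes[OF part] by metis
    then show "?T c = undefined" using T c by (auto simp: SSYT_def)
  qed
  have row: "?T (r, j) \<le> ?T (r, j')"
    if d: "(r, j) \<in> diagram lam mu" "(r, j') \<in> diagram lam mu" "j < j'" for r j j'
  proof -
    have "lam r \<noteq> 0" using d by (auto simp: diagram_def)
    then have "r < partition_length lam" using support_partition[OF part] by blast
    then obtain A C where bs: "reading_boxes lam mu = A @ row_boxes lam mu r @ C"
      by (rule reading_boxes_row)
    have "\<forall>i j j'. (i, j) \<in> diagram lam mu \<and> (i, j') \<in> diagram lam mu \<and> j < j' \<longrightarrow> T (i, j) \<le> T (i, j')"
      using T by (simp add: SSYT_def)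
    then have "T (r, c) \<le> T (r, c')" if "mu r \<le> c" "c < c'" "c' < lam r" for c c'
      using that by (force simp: diagram_def)
    then have "sorted (map T (row_boxes lam mu r))"
      by (simp add: row_boxes_def sorted_iff_nth_mono_less)
    then have s: "sorted (map ?T (row_boxes lam mu r))"
      unfolding crystal_reflection_segment[OF bs] by (rule sorted_reflect_from)
    show ?thesis
      using sorted_nth_mono[OF s, of "j - mu r" "j' - mu r"] d by (auto simp: row_boxes_def diagram_def)
  qed
  have col1: "?T (r, j) < ?T (Suc r, j)"
    if d: "(r, j) \<in> diagram lam mu" "(Suc r, j) \<in> diagram lam mu" for r j
  proof -
    have lt: "T (r, j) < T (Suc r, j)" using T d by (auto simp: SSYT_def)
    show ?thesis
    proof (cases "T (r, j) = i \<and> T (Suc r, j) = Suc i")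
      case True
      then show ?thesis using vertical_pair_fixed[OF shape T d] by simp
    next
      case False
      have "?T c = T c \<or> T c \<in> {i, Suc i} \<and> ?T c \<in> {i, Suc i}" for c
        using crystal_reflection_changed[of lam mu i T c] by blast
      from this[of "(r, j)"] this[of "(Suc r, j)"] show ?thesis using False lt by auto
    qed
  qed
  have col: "?T (r, j) < ?T (r', j)"
    if "(r, j) \<in> diagram lam mu" "(r', j) \<in> diagram lam mu" "r < r'" for r r' j
    using that(3,1,2)
  proof (induction rule: less_Suc_induct)
    case (1 k)
    then show ?case by (rule col1)
  next
    case (2 x y z)
    then have "(y, j) \<in> diagram lam mu"
      using lam[of y z] mu[of x y] by (auto simp: diagram_def)
    then show ?case using 2 by (meson less_trans)
  qed
  show ?thesis using ext row col by (simp add: SSYT_def)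
qed

section \<open>The cyclic action\<close>

lemma fold_crystal_reflection:
  assumes "skew_shape lam mu" "T \<in> SSYT lam mu n" "set is \<subseteq> {1..<n}"
  shows "fold (crystal_reflection lam mu) is T \<in> SSYT lam mu n \<and>
    map (fold (crystal_reflection lam mu) is T) (reading_boxes lam mu) =
      fold reflect_word is (map T (reading_boxes lam mu))"
  using assms(2,3)
proof (induction "is" arbitrary: T)
  case (Cons i "is")
  have "crystal_reflection lam mu i T \<in> SSYT lam mu n"
    using Cons.prems by (intro crystal_reflection_SSYT assms(1)) auto
  then show ?case
    using Cons.IH[of "crystal_reflection lam mu i T"] Cons.prems crystal_reflection_word[of lam mu i T] by simp
qed simp

lemma crystal_cycle_SSYT:
  assumes "skew_shape lam mu" "T \<in> SSYT lam mu n"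
  shows "crystal_cycle lam mu n T \<in> SSYT lam mu n"
    and "map (crystal_cycle lam mu n T) (reading_boxes lam mu) = words.coxeter n (map T (reading_boxes lam mu))"
  using fold_crystal_reflection[OF assms, of "[1..<n]"]
  by (auto simp: crystal_cycle_def words.coxeter_def)

lemma crystal_cycle_power_SSYT:
  assumes "skew_shape lam mu" "T \<in> SSYT lam mu n"
  shows "(crystal_cycle lam mu n ^^ k) T \<in> SSYT lam mu n \<and>
     map ((crystal_cycle lam mu n ^^ k) T) (reading_boxes lam mu) =
       (words.coxeter n ^^ k) (map T (reading_boxes lam mu))"
  by (induction k) (use assms crystal_cycle_SSYT[OF assms(1)] in simp_all)

text \<open>
  Relations between reflections of words thus become relations between crystal reflections.
\<close>

lemma SSYT_eqI:
  assumes "skew_shape lam mu" "T \<in> SSYT lam mu n" "T' \<in> SSYT lam mu n"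
    and "map T (reading_boxes lam mu) = map T' (reading_boxes lam mu)"
  shows "T = T'"
proof (rule PiE_ext)
  show "T \<in> diagram lam mu \<rightarrow>\<^sub>E {1..n}" "T' \<in> diagram lam mu \<rightarrow>\<^sub>E {1..n}"
    using assms by (auto simp: SSYT_def)
  have "set (reading_boxes lam mu) = diagram lam mu"
    using assms(1) by (intro set_reading_boxes) (simp add: skew_shape_def)
  then show "T b = T' b" if "b \<in> diagram lam mu" for b
    using assms(4) that by (metis map_eq_conv)
qed

lemma crystal_cycle_order:
  assumes "skew_shape lam mu" "T \<in> SSYT lam mu n"
  shows "(crystal_cycle lam mu n ^^ n) T = T"
  using crystal_cycle_power_SSYT[OF assms, of n] assms
  by (intro SSYT_eqI[OF assms(1)]) (auto simp: words.coxeter_order)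

lemma transpositions_coxeter:
  assumes "1 \<le> x" "1 \<le> k"
  shows "transpositions.coxeter k x = (if x = 1 then k else if x \<le> k then x - 1 else x)"
  using assms(2)
proof (induction k rule: dec_induct)
  case base
  then show ?case using assms(1) by (simp add: transpositions.coxeter_trivial)
next
  case (step k)
  have "transpositions.coxeter (Suc k) x = transpose k (Suc k) (transpositions.coxeter k x)"
    by (rule transpositions.coxeter_Suc) (use step in simp)
  also have "\<dots> = (if x = 1 then Suc k else if x \<le> Suc k then x - 1 else x)"
    unfolding step.IH using assms(1) by (auto simp: transpose_def)
  finally show ?case .
qed

lemma mset_words_coxeter: "mset (words.coxeter k w) = image_mset (transpositions.coxeter k) (mset w)"
proof (induction k)
  case 0
  show ?case by (simp add: words.coxeter_trivial transpositions.coxeter_trivial)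
next
  case (Suc k)
  then show ?case
    by (cases "k = 0")
      (simp_all add: words.coxeter_trivial transpositions.coxeter_trivial words.coxeter_Suc transpositions.coxeter_Suc
        mset_reflect_word multiset.map_comp comp_def)
qed

lemma sum_list_words_coxeter:
  assumes "n \<ge> 1" "set w \<subseteq> {1..n}"
  shows "sum_list (words.coxeter n w) + length w = sum_list w + n * count_list w 1"
proof -
  have "sum_list (words.coxeter n w) = sum_mset (image_mset (transpositions.coxeter n) (mset w))"
    by (metis mset_words_coxeter sum_mset_sum_list)
  also have "\<dots> = sum_list (map (transpositions.coxeter n) w)"
    by (metis mset_map sum_mset_sum_list)
  finally have "sum_list (words.coxeter n w) = sum_list (map (transpositions.coxeter n) w)" .
  moreover have "sum_list (map (transpositions.coxeter n) w) + length w = sum_list w + n * count_list w 1"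
    using assms(2)
  proof (induction w)
    case (Cons x w)
    then have "transpositions.coxeter n x + 1 = x + (if x = 1 then n else 0)"
      using assms(1) by (auto simp: transpositions_coxeter)
    then show ?case using Cons by (auto simp: algebra_simps)
  qed simp
  ultimately show ?thesis by simp
qed

definition entry_sum :: "(nat \<Rightarrow> nat) \<Rightarrow> (nat \<Rightarrow> nat) \<Rightarrow> (nat \<times> nat \<Rightarrow> nat) \<Rightarrow> nat" where
  "entry_sum lam mu T = (\<Sum>b \<in> diagram lam mu. T b)"

lemma finite_diagram: "is_partition lam \<Longrightarrow> finite (diagram lam mu)"
  using set_reading_boxes by (metis List.finite_set)

lemma card_diagram:
  assumes "skew_shape lam mu"
  shows "card (diagram lam mu) = skew_size lam mu"
proof -
  let ?L = "partition_length lam"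
  have part: "is_partition lam" and le: "\<And>i. mu i \<le> lam i" using assms by (auto simp: skew_shape_def)
  have "card (diagram lam mu) = length (reading_boxes lam mu)"
    using set_reading_boxes[OF part] distinct_reading_boxes by (metis distinct_card)
  also have "\<dots> = (\<Sum>i<?L. lam i - mu i)"
  proof -
    have "length (reading_boxes lam mu) = sum_list (rev (map (\<lambda>i. lam i - mu i) [0..<?L]))"
      by (simp add: reading_boxes_rows length_concat row_boxes_def comp_def rev_map)
    also have "\<dots> = sum_list (map (\<lambda>i. lam i - mu i) [0..<?L])" by (rule sum_list_rev)
    also have "\<dots> = (\<Sum>i<?L. lam i - mu i)"
      by (simp only: interv_sum_list_conv_sum_set_nat atLeast0LessThan set_upt)
    finally show ?thesis .
  qed
  also have "\<dots> = (\<Sum>i<?L. lam i) - (\<Sum>i<?L. mu i)"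
    using le by (rule sum_subtractf_nat)
  also have "(\<Sum>i<?L. lam i) = partition_size lam"
    by (simp only: partition_size_def support_partition[OF part])
  also have "(\<Sum>i<?L. mu i) = partition_size mu"
    unfolding partition_size_def
  proof (rule sum.mono_neutral_right)
    have "i < ?L" if "mu i \<noteq> 0" for i
      using that le[of i] support_partition[OF part] by (metis (mono_tags) lessThan_iff le_zero_eq mem_Collect_eq)
    then show "{i. mu i \<noteq> 0} \<subseteq> {..<?L}" by auto
  qed auto
  finally show ?thesis by (simp add: skew_size_def)
qed

lemma entry_sum_word:
  assumes "is_partition lam"
  shows "entry_sum lam mu T = sum_list (map T (reading_boxes lam mu))"
  using set_reading_boxes[OF assms, of mu] distinct_reading_boxes[of lam mu]
  by (metis entry_sum_def sum.distinct_set_conv_list)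

text \<open>
  The number \<open>m\<close> is the number of entries \<open>1\<close>, each of which becomes \<open>n\<close> instead of \<open>0\<close>.
\<close>

lemma entry_sum_crystal_cycle:
  assumes shape: "skew_shape lam mu" and T: "T \<in> SSYT lam mu n" and n: "n \<ge> 1"
  shows "\<exists>m. entry_sum lam mu (crystal_cycle lam mu n T) + skew_size lam mu = entry_sum lam mu T + n * m"
proof -
  let ?w = "map T (reading_boxes lam mu)"
  have part: "is_partition lam" using shape by (simp add: skew_shape_def)
  have "length ?w = skew_size lam mu"
    using card_diagram[OF shape] set_reading_boxes[OF part] distinct_reading_boxes
    by (metis distinct_card length_map)
  moreover have "set ?w \<subseteq> {1..n}"
    using T set_reading_boxes[OF part, of mu] by (auto simp: SSYT_def)
  ultimately have "entry_sum lam mu (crystal_cycle lam mu n T) + skew_size lam mu =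
      entry_sum lam mu T + n * count_list ?w 1"
    using sum_list_words_coxeter[OF n, of ?w] crystal_cycle_SSYT(2)[OF shape T]
    by (simp only: entry_sum_word[OF part])
  then show ?thesis by blast
qed

lemma entry_sum_crystal_cycle_power:
  assumes shape: "skew_shape lam mu" and T: "T \<in> SSYT lam mu n" and n: "n \<ge> 1"
  shows "\<exists>m. entry_sum lam mu ((crystal_cycle lam mu n ^^ k) T) + k * skew_size lam mu = entry_sum lam mu T + n * m"
proof (induction k)
  case 0
  show ?case by (rule exI[of _ 0]) simp
next
  case (Suc k)
  then obtain m where m: "entry_sum lam mu ((crystal_cycle lam mu n ^^ k) T) + k * skew_size lam mu = entry_sum lam mu T + n * m"
    by blast
  obtain m' where "entry_sum lam mu (crystal_cycle lam mu n ((crystal_cycle lam mu n ^^ k) T)) + skew_size lam mu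
      = entry_sum lam mu ((crystal_cycle lam mu n ^^ k) T) + n * m'"
    using entry_sum_crystal_cycle[OF shape _ n] crystal_cycle_power_SSYT[OF shape T] by blast
  then show ?case using m by (intro exI[of _ "m + m'"]) (simp add: algebra_simps)
qed

lemma fixed_point_power:
  assumes "skew_shape lam mu" "T \<in> SSYT lam mu n" "n \<ge> 1" "coprime (skew_size lam mu) n"
    and "(crystal_cycle lam mu n ^^ k) T = T"
  shows "n dvd k"
proof -
  obtain m where "k * skew_size lam mu = n * m"
    using entry_sum_crystal_cycle_power[OF assms(1-3), of k] assms(5) by auto
  then have "n dvd k * skew_size lam mu" by simp
  then show ?thesis using assms(4) by (simp add: coprime_commute coprime_dvd_mult_left_iff)
qed

section \<open>The principal specialization at roots of unity\<close>

lemma finite_SSYT: "is_partition lam \<Longrightarrow> finite (SSYT lam mu n)"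
  by (rule finite_subset[of _ "diagram lam mu \<rightarrow>\<^sub>E {1..n}"])
    (auto simp: SSYT_def intro!: finite_PiE finite_diagram)

text \<open>
  The exponent of \<open>q\<close> that a tableau contributes to the principal specialization.
\<close>

definition rank :: "(nat \<Rightarrow> nat) \<Rightarrow> (nat \<Rightarrow> nat) \<Rightarrow> (nat \<times> nat \<Rightarrow> nat) \<Rightarrow> nat" where
  "rank lam mu T = (\<Sum>b \<in> diagram lam mu. T b - 1)"

lemma rank_entry_sum:
  assumes "skew_shape lam mu" "T \<in> SSYT lam mu n"
  shows "rank lam mu T + skew_size lam mu = entry_sum lam mu T"
proof -
  have "rank lam mu T + skew_size lam mu = (\<Sum>b \<in> diagram lam mu. T b - 1 + 1)"
    unfolding card_diagram[OF assms(1), symmetric] sum.distrib by (simp add: rank_def)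
  also have "\<dots> = entry_sum lam mu T"
    unfolding entry_sum_def using assms(2) by (intro sum.cong) (force simp: SSYT_def)+
  finally show ?thesis .
qed

lemma principal_schur_rank:
  assumes "is_partition lam"
  shows "principal_schur lam mu n = (\<Sum>T \<in> SSYT lam mu n. Polynomial.monom 1 (rank lam mu T))"
  unfolding principal_schur_def skew_schur_def
proof (rule sum.cong)
  fix T assume T: "T \<in> SSYT lam mu n"
  have "(\<Sum>i = 1..n. (i - 1) * weight lam mu T i) = (\<Sum>i = 1..n. \<Sum>b \<in> {b \<in> diagram lam mu. T b = i}. T b - 1)"
    by (intro sum.cong) (auto simp: weight_def)
  also have "\<dots> = rank lam mu T"
    unfolding rank_def using T by (intro sum.group finite_diagram assms) (auto simp: SSYT_def)
  finally have "(\<Sum>i = 1..n. (i - 1) * weight lam mu T i) = rank lam mu T" .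
  then show "(\<Prod>i = 1..n. ([:0, 1:] ^ (i - 1)) ^ weight lam mu T i) = (Polynomial.monom 1 (rank lam mu T) :: int poly)"
    by (simp add: monom_altdef flip: power_mult power_sum)
qed simp

lemma coprime_roots_of_unity:
  fixes x :: complex
  assumes "x ^ n = 1" "x ^ m = 1" "coprime m n" "n \<ge> 1"
  shows "x = 1"
proof (cases "m = 0")
  case True
  then show ?thesis using assms by simp
next
  case False
  obtain a b where "m * a = n * b + gcd m n" using bezout_nat[OF False] by blast
  then have "x ^ (m * a) = x ^ (n * b) * x" using assms by simp
  then show ?thesis using assms by (simp add: power_mult)
qed

text \<open>
  Reindexing along the bijection \<open>crystal_cycle\<close> shows that multiplication by \<open>x ^ N\<close> does not
  change the sum, where \<open>N\<close> is the number of boxes; and \<open>x ^ N \<noteq> 1\<close>.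
\<close>

lemma sum_rank_root_of_unity:
  fixes x :: complex
  assumes shape: "skew_shape lam mu" and n: "n \<ge> 1" and cop: "coprime (skew_size lam mu) n"
    and x: "x ^ n = 1" "x \<noteq> 1"
  shows "(\<Sum>T \<in> SSYT lam mu n. x ^ rank lam mu T) = 0"
proof -
  let ?X = "SSYT lam mu n" and ?c = "crystal_cycle lam mu n" and ?N = "skew_size lam mu"
  have inv: "?c ((?c ^^ (n - 1)) T) = T" "(?c ^^ (n - 1)) (?c T) = T" if "T \<in> ?X" for T
    using crystal_cycle_order[OF shape that] n
    by (cases n; simp add: funpow_swap1)+
  have "bij_betw ?c ?X ?X"
    by (rule bij_betwI[of _ _ _ "?c ^^ (n - 1)"])
      (use inv crystal_cycle_SSYT[OF shape] crystal_cycle_power_SSYT[OF shape] in auto)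
  then have "(\<Sum>T \<in> ?X. x ^ rank lam mu T) * x ^ ?N = (\<Sum>T \<in> ?X. x ^ rank lam mu (?c T)) * x ^ ?N"
    by (subst sum.reindex_bij_betw[symmetric]) auto
  also have "\<dots> = (\<Sum>T \<in> ?X. x ^ rank lam mu T)"
    unfolding sum_distrib_right
  proof (rule sum.cong)
    fix T assume T: "T \<in> ?X"
    obtain m where "entry_sum lam mu (?c T) + ?N = entry_sum lam mu T + n * m"
      using entry_sum_crystal_cycle[OF shape T n] by blast
    then have "rank lam mu (?c T) + ?N = rank lam mu T + n * m"
      using rank_entry_sum[OF shape T] rank_entry_sum[OF shape crystal_cycle_SSYT(1)[OF shape T]] by linarith
    then show "x ^ rank lam mu (?c T) * x ^ ?N = x ^ rank lam mu T"
      using x(1) by (metis power_add power_mult power_one mult.right_neutral)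
  qed simp
  finally have "(\<Sum>T \<in> ?X. x ^ rank lam mu T) * (x ^ ?N - 1) = 0" by (simp add: algebra_simps)
  moreover have "x ^ ?N \<noteq> 1" using coprime_roots_of_unity[OF x(1) _ cop n] x(2) by blast
  ultimately show ?thesis by simp
qed

lemma poly_of_int_sum_monom:
  "poly (map_poly of_int (\<Sum>a \<in> A. Polynomial.monom 1 (f a))) x = (\<Sum>a \<in> A. (x :: complex) ^ f a)"
proof (induction A rule: infinite_finite_induct)
  case (insert a A)
  have "map_poly of_int (p + q) = (map_poly of_int p + map_poly of_int q :: complex poly)" for p q
    by (simp add: poly_eq_iff coeff_map_poly)
  then show ?case using insert by (simp add: map_poly_monom poly_monom)
qed auto

text \<open>
  In a straight shape every column starts in row \<open>0\<close>, so strictness forces \<open>T (i, j) > i\<close>.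
\<close>

lemma rank_ge_partition_n:
  assumes part: "is_partition lam" and T: "T \<in> SSYT lam empty_partition n"
  shows "partition_n lam \<le> rank lam empty_partition T"
proof -
  let ?D = "diagram lam empty_partition"
  have lam: "lam q \<le> lam p" if "p \<le> q" for p q
    using part that by (auto simp: is_partition_def antimono_def)
  have "i < T (i, j)" if "(i, j) \<in> ?D" for i j
    using that
  proof (induction i)
    case 0
    then show ?case using T by (force simp: SSYT_def)
  next
    case (Suc i)
    then have "(i, j) \<in> ?D" using lam[of i "Suc i"] by (auto simp: diagram_def empty_partition_def)
    moreover from this have "T (i, j) < T (Suc i, j)" using T Suc.prems by (auto simp: SSYT_def)
    ultimately show ?case using Suc.IH by simp
  qed
  then have "(\<Sum>b \<in> ?D. fst b) \<le> rank lam empty_partition T"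
    unfolding rank_def by (intro sum_mono) force
  moreover have "(\<Sum>b \<in> ?D. fst b) = partition_n lam"
  proof -
    have D: "?D = Sigma {i. lam i \<noteq> 0} (\<lambda>i. {..<lam i})"
      by (auto simp: diagram_def empty_partition_def)
    have fin: "finite {i. lam i \<noteq> 0}" using part by (simp add: is_partition_def)
    have "(\<Sum>b \<in> ?D. fst b) = (\<Sum>(i, j) \<in> Sigma {i. lam i \<noteq> 0} (\<lambda>i. {..<lam i}). i)"
      unfolding D by (intro sum.cong refl) (simp add: case_prod_beta)
    also have "\<dots> = (\<Sum>i | lam i \<noteq> 0. \<Sum>j<lam i. i)"
      using fin by (intro sum.Sigma[symmetric]) blast+
    finally have "(\<Sum>b \<in> ?D. fst b) = (\<Sum>i | lam i \<noteq> 0. \<Sum>j<lam i. i)" .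
    then show ?thesis by (simp add: partition_n_def mult.commute)
  qed
  ultimately show ?thesis by simp
qed

section \<open>The cyclic group\<close>

lemma cycle_perm_coxeter: "cycle_perm n = transpositions.coxeter n"
proof -
  have "fold (\<lambda>i p. transpose i (Suc i) \<circ> p) is q = fold (\<lambda>i. transpose i (Suc i)) is \<circ> q" for "is" q
    by (induction "is" arbitrary: q) (auto simp: o_assoc)
  from this[of "[1..<n]" id] show ?thesis by (simp add: cycle_perm_def transpositions.coxeter_def)
qed

lemma cycle_perm_permutes: "cycle_perm n permutes {1..n}"
proof -
  have "fold (\<lambda>i p. transpose i (Suc i) \<circ> p) is q permutes {1..n}"
    if "set is \<subseteq> {1..<n}" "q permutes {1..n}" for "is" q
    using that
  proof (induction "is" arbitrary: q)
    case (Cons i "is")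
    then have q: "transpose i (Suc i) \<circ> q permutes {1..n}"
      by (intro permutes_compose permutes_swap_id) auto
    have "set is \<subseteq> {1..<n}" using Cons.prems by simp
    then have "fold (\<lambda>i p. transpose i (Suc i) \<circ> p) is (transpose i (Suc i) \<circ> q) permutes {1..n}"
      using q by (rule Cons.IH)
    then show ?case by (simp only: fold_simps)
  qed simp
  from this[of "[1..<n]" id] show ?thesis by (simp add: cycle_perm_def permutes_id)
qed

lemma cycle_perm_power_mod: "cycle_perm n ^^ (k mod n) = cycle_perm n ^^ k"
  by (rule ext) (simp add: cycle_perm_coxeter funpow_mod_eq transpositions.coxeter_order)

text \<open>
  The iterated images of the largest point are distinct, so the order of the cycle is exactly \<open>n\<close>.
\<close>

lemma cycle_perm_power_top:
  assumes "k < n"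
  shows "(cycle_perm n ^^ k) n = n - k"
  using assms
proof (induction k)
  case (Suc k)
  then have "(cycle_perm n ^^ Suc k) n = transpositions.coxeter n (n - k)"
    by (simp add: cycle_perm_coxeter)
  also have "\<dots> = n - Suc k" using Suc.prems by (subst transpositions_coxeter) auto
  finally show ?case .
qed simp

lemma cycle_perm_power_eq_iff:
  assumes "n \<ge> 1"
  shows "cycle_perm n ^^ k = cycle_perm n ^^ l \<longleftrightarrow> k mod n = l mod n"
proof
  assume "cycle_perm n ^^ k = cycle_perm n ^^ l"
  then have "(cycle_perm n ^^ (k mod n)) n = (cycle_perm n ^^ (l mod n)) n"
    by (simp only: cycle_perm_power_mod)
  then have "n - k mod n = n - l mod n"
    using assms by (simp add: cycle_perm_power_top)
  moreover have "k mod n < n" "l mod n < n" using assms by auto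
  ultimately show "k mod n = l mod n" by linarith
next
  assume "k mod n = l mod n"
  then show "cycle_perm n ^^ k = cycle_perm n ^^ l" by (metis cycle_perm_power_mod)
qed

lemma sym_group_power: "p \<in> carrier (sym_group n) \<Longrightarrow> p [^]\<^bsub>sym_group n\<^esub> (k::nat) = p ^^ k"
proof (induction k)
  case 0
  interpret group "sym_group n" by (rule sym_group_is_group)
  show ?case by (simp add: sym_group_one)
next
  case (Suc k)
  interpret group "sym_group n" by (rule sym_group_is_group)
  show ?case using Suc by (simp add: sym_group_mult funpow_swap1 fun_eq_iff)
qed

lemma carrier_cycle_group:
  assumes "n \<ge> 1"
  shows "carrier (cycle_group n) = (\<lambda>k. cycle_perm n ^^ k) ` {..<n}"
proof -
  interpret group "sym_group n" by (rule sym_group_is_group)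
  have p: "cycle_perm n \<in> carrier (sym_group n)"
    by (simp only: sym_group_carrier cycle_perm_permutes)
  have fin: "finite (carrier (sym_group n))"
    by (simp add: sym_group_def finite_permutations)
  have "carrier (cycle_group n) = generate (sym_group n) {cycle_perm n}"
    using p by (simp add: cycle_group_def carrier_subgroup_generated)
  also have "\<dots> = range (\<lambda>k. cycle_perm n ^^ k)"
    using generate_pow_on_finite_carrier[OF fin p] sym_group_power[OF p] by auto
  also have "\<dots> = (\<lambda>k. cycle_perm n ^^ k) ` {..<n}"
  proof
    show "range (\<lambda>k. cycle_perm n ^^ k) \<subseteq> (\<lambda>k. cycle_perm n ^^ k) ` {..<n}"
    proof
      fix q assume "q \<in> range (\<lambda>k. cycle_perm n ^^ k)"
      then obtain k where "q = cycle_perm n ^^ k" by auto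
      then show "q \<in> (\<lambda>k. cycle_perm n ^^ k) ` {..<n}"
        using assms by (intro image_eqI[of _ _ "k mod n"]) (auto simp: cycle_perm_power_mod)
    qed
  qed auto
  finally show ?thesis .
qed

lemma card_cycle_group:
  assumes "n \<ge> 1"
  shows "card (carrier (cycle_group n)) = n"
proof -
  have "inj_on (\<lambda>k. cycle_perm n ^^ k) {..<n}"
    by (rule inj_onI) (simp add: cycle_perm_power_eq_iff[OF assms])
  then show ?thesis by (simp add: carrier_cycle_group[OF assms] card_image)
qed

lemma group_cycle_group: "group (cycle_group n)"
  unfolding cycle_group_def by (intro group.group_subgroup_generated sym_group_is_group)

lemma cyclic_group_cycle_group: "cyclic_group (cycle_group n)"
  unfolding cycle_group_def by (intro group.cyclic_group_generated sym_group_is_group)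

lemma cycle_group_mult: "mult (cycle_group n) = (\<circ>)" and cycle_group_one: "one (cycle_group n) = id"
  by (simp_all add: cycle_group_def subgroup_generated_def sym_group_def)

text \<open>
  The exponent chosen by \<open>LEAST\<close> is \<open>k mod n\<close>, which is harmless since both cycles have period \<open>n\<close>.
\<close>

lemma cycle_action_power:
  assumes shape: "skew_shape lam mu" and n: "n \<ge> 1" and T: "T \<in> SSYT lam mu n"
  shows "cycle_action lam mu n (cycle_perm n ^^ k) T = (crystal_cycle lam mu n ^^ k) T"
proof -
  have "(LEAST l. cycle_perm n ^^ l = cycle_perm n ^^ k) = k mod n"
  proof (rule Least_equality)
    show "k mod n \<le> l" if "cycle_perm n ^^ l = cycle_perm n ^^ k" for l
      using that by (metis cycle_perm_power_eq_iff[OF n] mod_less_eq_dividend)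
  qed (rule cycle_perm_power_mod)
  then show ?thesis
    using T funpow_mod_eq[OF crystal_cycle_order[OF shape T]] by (simp add: cycle_action_def)
qed

lemma group_action_cycle_action:
  assumes shape: "skew_shape lam mu" and n: "n \<ge> 1"
  shows "group_action (cycle_group n) (SSYT lam mu n) (cycle_action lam mu n)"
proof -
  let ?X = "SSYT lam mu n" and ?c = "crystal_cycle lam mu n" and ?act = "cycle_action lam mu n"
  have closed: "(?c ^^ k) T \<in> ?X" if "T \<in> ?X" for k T
    using crystal_cycle_power_SSYT[OF shape that] by blast
  have period: "(?c ^^ (k * n)) T = T" if "T \<in> ?X" for k T
    using funpow_mod_eq[OF crystal_cycle_order[OF shape that], of "k * n"] by simp
  have bij: "?act (cycle_perm n ^^ k) \<in> Bij ?X" for k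
  proof -
    have sum: "k + (k * n - k) = k * n" "(k * n - k) + k = k * n" using n by (cases n; simp)+
    have "bij_betw (?act (cycle_perm n ^^ k)) ?X ?X"
    proof (rule bij_betwI[of _ _ _ "?c ^^ (k * n - k)"])
      show "(?c ^^ (k * n - k)) (?act (cycle_perm n ^^ k) T) = T" if "T \<in> ?X" for T
        using that period[OF that, of k] sum by (metis cycle_action_power[OF shape n that] comp_apply funpow_add)
      show "?act (cycle_perm n ^^ k) ((?c ^^ (k * n - k)) T) = T" if "T \<in> ?X" for T
        using that period[OF that, of k] sum
        by (metis cycle_action_power[OF shape n closed[OF that]] comp_apply funpow_add)
    qed (auto simp: cycle_action_power[OF shape n] closed)
    moreover have "?act (cycle_perm n ^^ k) \<in> extensional ?X" by (simp add: cycle_action_def)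
    ultimately show ?thesis by (simp add: Bij_def)
  qed
  have "?act (cycle_perm n ^^ k \<circ> cycle_perm n ^^ l) = compose ?X (?act (cycle_perm n ^^ k)) (?act (cycle_perm n ^^ l))" for k l
  proof (rule extensionalityI)
    show "?act (cycle_perm n ^^ k \<circ> cycle_perm n ^^ l) \<in> extensional ?X" by (simp add: cycle_action_def)
    show "?act (cycle_perm n ^^ k \<circ> cycle_perm n ^^ l) T = compose ?X (?act (cycle_perm n ^^ k)) (?act (cycle_perm n ^^ l)) T"
      if "T \<in> ?X" for T
    proof -
      have "?act (cycle_perm n ^^ k \<circ> cycle_perm n ^^ l) T = (?c ^^ k) ((?c ^^ l) T)"
        using cycle_action_power[OF shape n that, of "k + l"] by (simp add: funpow_add)
      then show ?thesis
        using that closed[OF that, of l] by (simp add: compose_def cycle_action_power[OF shape n])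
    qed
  qed simp
  then have "?act \<in> hom (cycle_group n) (BijGroup ?X)"
    using bij by (auto simp: hom_def BijGroup_def carrier_cycle_group[OF n] cycle_group_mult)
  then show ?thesis
    by (intro group_action.intro group_hom.intro group_hom_axioms.intro group_cycle_group group_BijGroup)
qed

section \<open>Cyclic sieving\<close>

text \<open>
  If \<open>n\<close> divides \<open>k\<close>, both sides count all tableaux. Otherwise \<open>\<xi>^k\<close> is a root of unity other than
  \<open>1\<close>, and the \<open>k\<close>-th power of the generator is a power of the \<open>n\<close>-cycle with exponent strictly
  between \<open>0\<close> and \<open>n\<close>, which has no fixed points.
\<close>

lemma cyclic_sieving_cycle_action:
  assumes shape: "skew_shape lam mu" and n: "n \<ge> 1" and cop: "coprime (skew_size lam mu) n"
    and one: "poly (map_poly of_int f) (1 :: complex) = of_nat (card (SSYT lam mu n))"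
    and root: "\<And>x :: complex. x ^ n = 1 \<Longrightarrow> x \<noteq> 1 \<Longrightarrow> poly (map_poly of_int f) x = 0"
  shows "cyclic_sieving (SSYT lam mu n) (cycle_group n) (cycle_action lam mu n) f"
  unfolding cyclic_sieving_def
proof (intro conjI ballI allI impI)
  let ?C = "cycle_group n" and ?X = "SSYT lam mu n" and ?act = "cycle_action lam mu n"
  interpret C: group ?C by (rule group_cycle_group)
  show "finite ?X" using shape by (intro finite_SSYT) (simp add: skew_shape_def)
  show fin: "finite (carrier ?C)" using n by (simp add: carrier_cycle_group)
  show "cyclic_group ?C" by (rule cyclic_group_cycle_group)
  show "group_action ?C ?X ?act" by (rule group_action_cycle_action[OF shape n])
  fix g \<xi> and k :: int
  assume g: "g \<in> carrier ?C"
    and gen: "subgroup_generated ?C {g} = ?C \<and> primitive_root_of_unity (card (carrier ?C)) \<xi>"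
  have "C.ord g = n"
    using C.generate_pow_card[OF g] gen g card_cycle_group[OF n]
    by (metis carrier_subgroup_generated Int_insert_right_if1 Int_empty_right)
  then have g_one: "g [^]\<^bsub>?C\<^esub> k = \<one>\<^bsub>?C\<^esub> \<longleftrightarrow> int n dvd k"
    using C.int_pow_eq_id[OF g] by simp
  have \<xi>: "\<xi> ^ n = 1" "\<And>m. 0 < m \<Longrightarrow> m < n \<Longrightarrow> \<xi> ^ m \<noteq> 1"
    using gen card_cycle_group[OF n] by (auto simp: primitive_root_of_unity_def)
  have "\<xi> \<noteq> 0" using \<xi>(1) n by (metis power_0_left zero_neq_one not_one_le_zero)
  have "\<xi> powi k = \<xi> powi (k mod int n)"
  proof -
    have "\<xi> powi k = \<xi> powi (int n * (k div int n) + k mod int n)" by simp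
    also have "\<dots> = (\<xi> powi int n) powi (k div int n) * \<xi> powi (k mod int n)"
      using \<open>\<xi> \<noteq> 0\<close> by (simp only: power_int_add power_int_mult simp_thms)
    finally show ?thesis using \<xi>(1) by simp
  qed
  also have "\<dots> = \<xi> ^ nat (k mod int n)"
    using n by (simp add: power_int_def)
  finally have powi: "\<xi> powi k = \<xi> ^ nat (k mod int n)" .
  show "of_nat (card {x \<in> ?X. ?act (g [^]\<^bsub>?C\<^esub> k) x = x}) = poly (map_poly of_int f) (\<xi> powi k)"
  proof (cases "int n dvd k")
    case True
    have "?act (g [^]\<^bsub>?C\<^esub> k) T = T" if "T \<in> ?X" for T
      using g_one True cycle_action_power[OF shape n that, of 0] by (simp add: cycle_group_one id_def)
    then have "{x \<in> ?X. ?act (g [^]\<^bsub>?C\<^esub> k) x = x} = ?X" by auto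
    moreover have "\<xi> powi k = 1" using True powi by (simp add: dvd_eq_mod_eq_0)
    ultimately show ?thesis using one by simp
  next
    case False
    have "g [^]\<^bsub>?C\<^esub> k \<in> carrier ?C" using g by simp
    then obtain r where r: "r < n" "g [^]\<^bsub>?C\<^esub> k = cycle_perm n ^^ r"
      by (auto simp: carrier_cycle_group[OF n])
    have "r \<noteq> 0"
      using r(2) g_one False by (auto simp: cycle_group_one id_def)
    then have "\<not> n dvd r" using r(1) by (auto dest: dvd_imp_le)
    then have "{x \<in> ?X. ?act (g [^]\<^bsub>?C\<^esub> k) x = x} = {}"
      using fixed_point_power[OF shape _ n cop] cycle_action_power[OF shape n] by (auto simp: r(2))
    then have "card {x \<in> ?X. ?act (g [^]\<^bsub>?C\<^esub> k) x = x} = 0" by (simp only: card.empty)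
    moreover have "k mod int n \<noteq> 0" "0 \<le> k mod int n" "k mod int n < int n"
      using False n by (simp_all add: dvd_eq_mod_eq_0)
    then have "\<xi> powi k \<noteq> 1" unfolding powi by (intro \<xi>(2)) auto
    moreover have "(\<xi> powi k) ^ n = 1" unfolding powi using \<xi>(1)
      by (metis power_mult mult.commute power_one)
    ultimately show ?thesis using root by simp
  qed
qed

theorem corollary7:
  fixes n :: nat and lam mu :: "nat \<Rightarrow> nat"
  assumes "n \<ge> 1"
    and "skew_shape lam mu"
    and "gcd (skew_size lam mu) n = 1"
  shows "cyclic_sieving (SSYT lam mu n) (cycle_group n) (cycle_action lam mu n)
           (principal_schur lam mu n)
       \<and> (mu = empty_partition \<longrightarrow>
           Polynomial.monom 1 (partition_n lam) dvd principal_schur lam empty_partition n \<and>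
           cyclic_sieving (SSYT lam empty_partition n) (cycle_group n)
             (cycle_action lam empty_partition n)
             (principal_schur lam empty_partition n div Polynomial.monom 1 (partition_n lam)))"
proof (intro conjI impI)
  have part: "is_partition lam" using assms(2) by (simp add: skew_shape_def)
  have cop: "coprime (skew_size lam mu) n" using assms(3) by (simp add: coprime_iff_gcd_eq_1)
  show "cyclic_sieving (SSYT lam mu n) (cycle_group n) (cycle_action lam mu n) (principal_schur lam mu n)"
    by (rule cyclic_sieving_cycle_action[OF assms(2,1) cop])
      (simp_all add: principal_schur_rank[OF part] poly_of_int_sum_monom
        sum_rank_root_of_unity[OF assms(2,1) cop])
  assume mu: "mu = empty_partition"
  let ?X = "SSYT lam empty_partition n"
  define g :: "int poly" where
    "g = (\<Sum>T \<in> ?X. Polynomial.monom 1 (rank lam empty_partition T - partition_n lam))"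
  have factor: "principal_schur lam empty_partition n = Polynomial.monom 1 (partition_n lam) * g"
    unfolding principal_schur_rank[OF part] g_def sum_distrib_left
    by (intro sum.cong) (simp_all add: mult_monom rank_ge_partition_n[OF part])
  then show "Polynomial.monom 1 (partition_n lam) dvd principal_schur lam empty_partition n" by simp
  have quotient: "principal_schur lam empty_partition n div Polynomial.monom 1 (partition_n lam) = g"
    unfolding factor by (simp add: monom_eq_0_iff)
  show "cyclic_sieving ?X (cycle_group n) (cycle_action lam empty_partition n)
      (principal_schur lam empty_partition n div Polynomial.monom 1 (partition_n lam))"
    unfolding quotient
  proof (rule cyclic_sieving_cycle_action)
    show "poly (map_poly of_int g) (1 :: complex) = of_nat (card ?X)"
      by (simp add: g_def poly_of_int_sum_monom)
    fix x :: complex assume x: "x ^ n = 1" "x \<noteq> 1"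
    have "x \<noteq> 0" using x(1) assms(1) by (auto simp: power_0_left)
    have "x ^ partition_n lam * (\<Sum>T \<in> ?X. x ^ (rank lam empty_partition T - partition_n lam)) =
        (\<Sum>T \<in> ?X. x ^ rank lam empty_partition T)"
      unfolding sum_distrib_left
      by (intro sum.cong) (simp_all add: rank_ge_partition_n[OF part] flip: power_add)
    also have "\<dots> = 0" using sum_rank_root_of_unity[OF assms(2,1) cop x] mu by simp
    finally show "poly (map_poly of_int g) x = 0"
      using \<open>x \<noteq> 0\<close> by (auto simp: g_def poly_of_int_sum_monom)
  qed (use assms cop mu in auto)
qed

end
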